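(* (1) For $j\in\mathbb{N}_0$ and $\mu,\nu\in\mathbb{C}$ with $\Re\mu,\Re\nu>-1$, and $x>0$, $$\Lambda_{1,j}^{\mu,\nu}(x)=\frac{1}{\pi\Gamma(\frac{\mu+1}{2})\Gamma(\frac{\nu+1}{2})}\int_0^\pi\!\!\int_0^\pi e^{-x\cos\phi}L_j^{\frac{\mu+\nu}{2}}\big(x(\cos\vartheta+\cos\phi)\big)\sin^\mu\vartheta\,\sin^\nu\phi\,d\phi\,d\vartheta,$$ $$\Lambda_{2,j}^{\mu,\nu}(x)=\frac{1}{\Gamma(\frac{\mu+1}{2})\Gamma(\frac{\nu+1}{2})}\int_0^\pi\!\!\int_0^\infty e^{-x\cosh\phi}L_j^{\frac{\mu+\nu}{2}}\big(x(\cos\vartheta+\cosh\phi)\big)\sin^\mu\vartheta\,\sinh^\nu\phi\,d\phi\,d\vartheta.$$ (2) For $\nu=-1$, $\Re\mu>-1$, $j\in\mathbb{N}_0$, $x>0$: $$\Lambda_{1,j}^{\mu,-1}(x)=\frac{1}{2\pi\Gamma(\frac{\mu+1}{2})}\sum_{i=0}^1\int_0^\pi e^{-(-1)^ix}L_j^{\frac{\mu-1}{2}}\big(x(\cos\vartheta+(-1)^i)\big)\sin^\mu\vartheta\,d\vartheta,$$ $$\Lambda_{2,j}^{\mu,-1}(x)=\frac{1}{2\Gamma(\frac{\mu+1}{2})}\int_0^\pi e^{-x}L_j^{\frac{\mu-1}{2}}\big(x(\cos\vartheta+1)\big)\sin^\mu\vartheta\,d\vartheta.$$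
   Context: $L_n^\alpha(x)=\sum_{k=0}^n\frac{(-1)^k}{k!}\binom{n+\alpha}{n-k}x^k$ are the Laguerre polynomials. Normalized modified Bessel functions: $\widetilde I_\alpha(z)=(z/2)^{-\alpha}I_\alpha(z)$, $\widetilde K_\alpha(z)=(z/2)^{-\alpha}K_\alpha(z)$. For $x>0$ and $t$ near $0$ (principal branch): $G_1^{\mu,\nu}(t,x)=(1-t)^{-\frac{\mu+\nu+2}{2}}\widetilde I_{\mu/2}(\tfrac{tx}{1-t})\widetilde I_{\nu/2}(\tfrac{x}{1-t})$, $G_2^{\mu,\nu}(t,x)=(1-t)^{-\frac{\mu+\nu+2}{2}}\widetilde I_{\mu/2}(\tfrac{tx}{1-t})\widetilde K_{\nu/2}(\tfrac{x}{1-t})$, and $\Lambda_{i,j}^{\mu,\nu}(x)$ ($i=1,2$) are the Taylor coefficients: $G_i^{\mu,\nu}(t,x)=\sum_{j\ge0}t^j\Lambda_{i,j}^{\mu,\nu}(x)$. *)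

theory Defs
  imports "HOL-Analysis.Analysis"
begin

definition laguerre :: "nat \<Rightarrow> complex \<Rightarrow> real \<Rightarrow> complex" where
  "laguerre n \<alpha> x =
     (\<Sum>k\<le>n. (-1) ^ k / of_nat (fact k) * ((of_nat n + \<alpha>) gchoose (n - k)) * of_real x ^ k)"

text \<open>Normalised modified Bessel function of the first kind,
  (z/2)^(-alpha) I_alpha(z), as the entire function given by its power series
  (the Gamma-reciprocal makes it well defined for every complex order).\<close>
definition bessel_I_norm :: "complex \<Rightarrow> complex \<Rightarrow> complex" where
  "bessel_I_norm \<alpha> z = (\<Sum>m. rGamma (of_nat m + \<alpha> + 1) * (z / 2) ^ (2 * m) / of_nat (fact m))"

text \<open>Modified Bessel function of the second kind (Macdonald function), for Re z > 0,
  K_alpha(z) = integral over [0,oo) of exp(-z cosh s) cosh(alpha s) ds.\<close>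
definition bessel_K :: "complex \<Rightarrow> complex \<Rightarrow> complex" where
  "bessel_K \<alpha> z = integral {0..} (\<lambda>s::real. exp (- z * cosh (of_real s)) * cosh (\<alpha> * of_real s))"

definition bessel_K_norm :: "complex \<Rightarrow> complex \<Rightarrow> complex" where
  "bessel_K_norm \<alpha> z = (z / 2) powr (- \<alpha>) * bessel_K \<alpha> z"

definition G1 :: "complex \<Rightarrow> complex \<Rightarrow> complex \<Rightarrow> real \<Rightarrow> complex" where
  "G1 \<mu> \<nu> t x = (1 - t) powr (- (\<mu> + \<nu> + 2) / 2)
      * bessel_I_norm (\<mu> / 2) (t * of_real x / (1 - t))
      * bessel_I_norm (\<nu> / 2) (of_real x / (1 - t))"

definition G2 :: "complex \<Rightarrow> complex \<Rightarrow> complex \<Rightarrow> real \<Rightarrow> complex" where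
  "G2 \<mu> \<nu> t x = (1 - t) powr (- (\<mu> + \<nu> + 2) / 2)
      * bessel_I_norm (\<mu> / 2) (t * of_real x / (1 - t))
      * bessel_K_norm (\<nu> / 2) (of_real x / (1 - t))"

definition Lambda1 :: "complex \<Rightarrow> complex \<Rightarrow> nat \<Rightarrow> real \<Rightarrow> complex" where
  "Lambda1 \<mu> \<nu> j x = (deriv ^^ j) (\<lambda>t. G1 \<mu> \<nu> t x) 0 / of_nat (fact j)"

definition Lambda2 :: "complex \<Rightarrow> complex \<Rightarrow> nat \<Rightarrow> real \<Rightarrow> complex" where
  "Lambda2 \<mu> \<nu> j x = (deriv ^^ j) (\<lambda>t. G2 \<mu> \<nu> t x) 0 / of_nat (fact j)"

end

theory Submission
  imports Defs "HOL-Complex_Analysis.Complex_Analysis" "HOL-Probability.Distributions"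
begin

unbundle no vec_syntax

text \<open>
  The generating function $\sum_j t^j L_j^\alpha(y) = (1-t)^{-\alpha-1} e^{-ty/(1-t)}$ can be
  integrated termwise in $y$ against suitable weights, by dominated convergence. Inserting the
  Poisson integrals of $\widetilde I_{\mu/2}$, $\widetilde I_{\nu/2}$ and $\widetilde K_{\nu/2}$
  (or the elementary closed forms at order $-1/2$) turns the two factors
  $(1-t)^{-(\mu+1)/2}\widetilde I_{\mu/2}(tx/(1-t))$ and $(1-t)^{-(\nu+1)/2}\widetilde I_{\nu/2}(x/(1-t))$
  (or the same with $\widetilde K$) into power series in $t$ whose coefficients are single integrals
  of $L_i^{(\mu-1)/2}$ and $L_i^{(\nu-1)/2}$. The Cauchy product of the two series becomes the double
  integral through the addition formula
  $L_j^{\alpha+\beta+1}(x+y) = \sum_i L_i^\alpha(x) L_{j-i}^\beta(y)$.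

  The Poisson integral of $\widetilde K$ is obtained for positive real arguments by Fubini's theorem
  from a representation of $e^{-zv}/v$ as a mixture of Gaussians in $v$, and extended to the complex
  arguments $x/(1-t)$ by the identity theorem.
\<close>

section \<open>Laguerre polynomials and their generating function\<close>

text \<open>Separating the two Bessel factors keeps the analysis one-dimensional: each needs one
  weight and one dominated convergence, and the double integral is only a finite sum of products of
  single integrals. The orders \<open>(\<mu> - 1) / 2\<close> and \<open>(\<nu> - 1) / 2\<close> are
  forced by the generating function, whose prefactors must multiply to that of \<open>G1\<close> and
  \<open>G2\<close>. The second factor has argument x/(1-t) instead of tx/(1-t); since 1/(1-t) = 1 +
  t/(1-t), the excess is the weight exp(-x cos phi) or exp(-x cosh phi) in the formulas. For the
  Macdonald function the variable x cosh phi is unbounded, so the weight must beat the majorant of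
  the Laguerre series; a majorant exp(x cosh phi / 2) still leaves exp(-x cosh phi / 2). The
  Gaussian mixture is evaluated by a translation by ln(z/(2v)), which is real only for positive z;
  this confines the direct argument to positive arguments. At order -1/2 the Poisson constant
  1/Gamma(0) degenerates and the weight collapses to the points cos phi = 1 and -1, or cosh phi = 1.
  The second Laguerre order is then -1, with prefactor 1.\<close>

definition fps_one_minus_powr :: "complex \<Rightarrow> complex fps" where
  "fps_one_minus_powr c = Abs_fps (\<lambda>n. (-1) ^ n * (c gchoose n))"

lemma one_minus_powr_sums:
  fixes t c :: complex
  assumes "norm t < 1"
  shows "(\<lambda>n. (-1) ^ n * (c gchoose n) * t ^ n) sums (1 - t) powr c"
  using gen_binomial_complex[of "-t" c] assms by (simp add: power_minus[of t] mult_ac)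

lemma eventually_norm_less_nhds_0: "r > 0 \<Longrightarrow> eventually (\<lambda>t::complex. norm t < r) (nhds 0)"
  by (auto simp: eventually_nhds_metric intro!: exI[of _ r])

lemma has_fps_expansion_one_minus_powr:
  "(\<lambda>t. (1 - t) powr c) has_fps_expansion fps_one_minus_powr c"
proof (rule has_fps_expansionI)
  show "\<forall>\<^sub>F t in nhds 0. (\<lambda>n. fps_one_minus_powr c $ n * t ^ n) sums (1 - t) powr c"
    by (rule eventually_mono[OF eventually_norm_less_nhds_0[of 1]])
       (simp_all add: fps_one_minus_powr_def one_minus_powr_sums)
qed

text \<open>This is the Vandermonde convolution for complex upper index. Uniqueness of expansions
  reduces it to \<open>powr_add\<close>, so no binomial sum has to be manipulated.\<close>

lemma fps_one_minus_powr_add: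
  "fps_one_minus_powr (c + d) = fps_one_minus_powr c * fps_one_minus_powr d"
proof (rule fps_expansion_unique_complex)
  show "(\<lambda>t. (1 - t) powr (c + d)) has_fps_expansion fps_one_minus_powr (c + d)"
    by (rule has_fps_expansion_one_minus_powr)
  have "(\<lambda>t. (1 - t) powr c * (1 - t) powr d) has_fps_expansion
          fps_one_minus_powr c * fps_one_minus_powr d"
    by (intro has_fps_expansion_mult has_fps_expansion_one_minus_powr)
  then show "(\<lambda>t. (1 - t) powr (c + d)) has_fps_expansion
          fps_one_minus_powr c * fps_one_minus_powr d"
    by (simp add: powr_add)
qed

lemma fps_one_minus_powr_0: "fps_one_minus_powr 0 = 1"
  by (auto simp: fps_eq_iff fps_one_minus_powr_def gbinomial_0_left)

lemma fps_one_minus_powr_power: "fps_one_minus_powr c ^ k = fps_one_minus_powr (of_nat k * c)"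
  by (induction k) (simp_all add: fps_one_minus_powr_0 fps_one_minus_powr_add ring_distribs)

text \<open>The exponential expands into terms (-y)^i / i! times t^i (1-t)^(-i). Multiplication by
  the prefactor only lowers the exponent of 1-t, so each coefficient of t^n is one binomial
  coefficient per i.\<close>

lemma has_fps_expansion_laguerre_kernel:
  "(\<lambda>t. (1 - t) powr (- \<alpha> - 1) * exp (- (t * of_real y / (1 - t)))) has_fps_expansion
     Abs_fps (\<lambda>n. laguerre n \<alpha> y)"
proof -
  define P where "P = fps_one_minus_powr (- \<alpha> - 1)"
  define G where "G = fps_X * fps_one_minus_powr (-1)"
  define E where "E = fps_exp (- complex_of_real y)"
  have G0: "G $ 0 = 0" by (simp add: G_def)
  have "(\<lambda>t. t * (1 - t) powr (-1)) has_fps_expansion G"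
    unfolding G_def by (intro fps_expansion_intros has_fps_expansion_one_minus_powr)
  from has_fps_expansion_compose[OF has_fps_expansion_exp this G0, of "- complex_of_real y"]
  have "(\<lambda>t. exp (- (t * of_real y / (1 - t)))) has_fps_expansion (E oo G)"
    by (simp add: o_def E_def powr_minus field_simps)
  then have *: "(\<lambda>t. (1 - t) powr (- \<alpha> - 1) * exp (- (t * of_real y / (1 - t)))) has_fps_expansion
       P * (E oo G)"
    unfolding P_def by (intro has_fps_expansion_mult has_fps_expansion_one_minus_powr)
  have "(P * (E oo G)) $ n = laguerre n \<alpha> y" for n
  proof -
    have GX: "G ^ i = fps_X ^ i * fps_one_minus_powr (- of_nat i)" for i
      by (simp add: G_def power_mult_distrib fps_one_minus_powr_power)
    have PG: "P * G ^ i = fps_X ^ i * fps_one_minus_powr (- \<alpha> - 1 - of_nat i)" for i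
      using fps_one_minus_powr_add[of "- \<alpha> - 1" "- of_nat i"]
      by (simp add: GX P_def mult_ac)
    have "(P * (E oo G)) $ n = (\<Sum>m=0..n. P $ (n - m) * (\<Sum>i=0..m. E $ i * (G ^ i) $ m))"
      by (subst mult.commute) (simp add: fps_mult_nth fps_compose_nth mult.commute[of _ "P $ _"])
    \<comment> \<open>\<open>G\<close> has no constant term, so \<open>G ^ i\<close> contributes
      nothing at m < i. Extending the inner range to n makes it independent of m, and the sums can
      be swapped.\<close>
    also have "\<dots> = (\<Sum>m=0..n. P $ (n - m) * (\<Sum>i=0..n. E $ i * (G ^ i) $ m))"
      by (intro sum.cong refl arg_cong2[where f = "(*)"] sum.mono_neutral_left)
         (auto simp: startsby_zero_power_prefix G0)
    also have "\<dots> = (\<Sum>i=0..n. E $ i * (\<Sum>m=0..n. (G ^ i) $ m * P $ (n - m)))"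
      unfolding sum_distrib_left by (subst sum.swap) (simp add: mult_ac)
    also have "\<dots> = (\<Sum>i=0..n. E $ i * (P * G ^ i) $ n)"
      by (subst mult.commute[of P]) (simp add: fps_mult_nth)
    also have "\<dots> = (\<Sum>i\<le>n. (-1) ^ i / of_nat (fact i) * ((of_nat n + \<alpha>) gchoose (n - i)) * of_real y ^ i)"
    proof (intro sum.cong)
      fix i assume "i \<in> {..n}"
      then have i: "i \<le> n" by simp
      have "(P * G ^ i) $ n = (-1) ^ (n - i) * ((- (\<alpha> + 1 + of_nat i)) gchoose (n - i))"
        using i by (simp add: PG fps_X_power_mult_nth fps_one_minus_powr_def diff_diff_eq)
      \<comment> \<open>Negating the upper index turns it into (\<alpha> + 1 + i) + (n - i) - 1 = n
        + \<alpha>, and the two signs cancel.\<close>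
      also have "\<dots> = (of_nat n + \<alpha>) gchoose (n - i)"
        using i by (subst gbinomial_minus) (simp add: of_nat_diff algebra_simps flip: power_add mult_2)
      finally show "E $ i * (P * G ^ i) $ n =
          (-1) ^ i / of_nat (fact i) * ((of_nat n + \<alpha>) gchoose (n - i)) * of_real y ^ i"
        by (simp add: E_def fps_exp_def power_minus[of "complex_of_real y"] field_simps)
    qed (auto simp: atMost_atLeast0)
    finally show ?thesis by (simp add: laguerre_def)
  qed
  then have "P * (E oo G) = Abs_fps (\<lambda>n. laguerre n \<alpha> y)"
    by (simp add: fps_eq_iff)
  with * show ?thesis by simp
qed

text \<open>The expansion near 0 extends to the whole unit disc because there 1 - t has positive
  real part, so the closed form meets neither the branch cut nor the pole. A definite radius is
  needed to evaluate the series at 1/3.\<close>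

lemma laguerre_sums:
  assumes "norm t < 1"
  shows "(\<lambda>n. laguerre n \<alpha> y * t ^ n) sums ((1 - t) powr (- \<alpha> - 1) * exp (- (t * of_real y / (1 - t))))"
proof -
  have "(\<lambda>n. Abs_fps (\<lambda>n. laguerre n \<alpha> y) $ n * t ^ n) sums
      ((1 - t) powr (- \<alpha> - 1) * exp (- (t * of_real y / (1 - t))))"
  proof (rule has_fps_expansion_imp_sums_complex[OF has_fps_expansion_laguerre_kernel])
    have "1 - z \<notin> \<real>\<^sub>\<le>\<^sub>0" "1 - z \<noteq> 0" if "norm z < 1" for z :: complex
      using that abs_Re_le_cmod[of z] by (auto simp: complex_nonpos_Reals_iff)
    then show "(\<lambda>t. (1 - t) powr (- \<alpha> - 1) * exp (- (t * of_real y / (1 - t)))) holomorphic_on eball 0 1"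
      by (intro holomorphic_intros) auto
  qed (use assms in auto)
  then show ?thesis by simp
qed

text \<open>The kernels multiply: the exponentials add in x and y, and the exponents satisfy
  (-\<alpha> - 1) + (-\<beta> - 1) = -(\<alpha> + \<beta> + 1) - 1, which explains the extra 1 in
  the order.\<close>

lemma laguerre_add:
  "laguerre j (\<alpha> + \<beta> + 1) (x + y) = (\<Sum>i=0..j. laguerre i \<alpha> x * laguerre (j - i) \<beta> y)"
proof -
  have "Abs_fps (\<lambda>n. laguerre n (\<alpha> + \<beta> + 1) (x + y)) =
      Abs_fps (\<lambda>n. laguerre n \<alpha> x) * Abs_fps (\<lambda>n. laguerre n \<beta> y)"
  proof (rule fps_expansion_unique_complex)
    show "(\<lambda>t. (1 - t) powr (- (\<alpha> + \<beta> + 1) - 1) * exp (- (t * of_real (x + y) / (1 - t))))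
        has_fps_expansion Abs_fps (\<lambda>n. laguerre n (\<alpha> + \<beta> + 1) (x + y))"
      by (rule has_fps_expansion_laguerre_kernel)
    have "(1 - t) powr (- (\<alpha> + \<beta> + 1) - 1) * exp (- (t * of_real (x + y) / (1 - t))) =
        ((1 - t) powr (- \<alpha> - 1) * exp (- (t * of_real x / (1 - t)))) *
        ((1 - t) powr (- \<beta> - 1) * exp (- (t * of_real y / (1 - t))))" for t :: complex
      using powr_add[of "1 - t" "- \<alpha> - 1" "- \<beta> - 1"]
      by (simp add: algebra_simps add_divide_distrib flip: exp_add)
    then show "(\<lambda>t. (1 - t) powr (- (\<alpha> + \<beta> + 1) - 1) * exp (- (t * of_real (x + y) / (1 - t))))
        has_fps_expansion Abs_fps (\<lambda>n. laguerre n \<alpha> x) * Abs_fps (\<lambda>n. laguerre n \<beta> y)"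
      by (simp only:) (intro has_fps_expansion_mult has_fps_expansion_laguerre_kernel)
  qed
  from arg_cong[OF this, of "\<lambda>F. F $ j"] show ?thesis
    by (simp add: fps_mult_nth)
qed

section \<open>Growth bounds for Laguerre polynomials and termwise integration\<close>

lemma norm_gbinomial_le:
  fixes a :: complex
  assumes "k \<le> n"
  shows "norm ((of_nat n + a) gchoose k) \<le> (of_nat n + norm a) gchoose k"
proof -
  have "norm ((of_nat n + a) gchoose k) = (\<Prod>i=0..<k. norm (of_nat n + a - of_nat i)) / fact k"
    by (simp add: gbinomial_prod_rev norm_divide prod_norm)
  also have "\<dots> \<le> (\<Prod>i=0..<k. real n + norm a - real i) / fact k"
  proof (intro divide_right_mono prod_mono conjI)
    fix i assume i: "i \<in> {0..<k}"
    \<comment> \<open>As i < k \<le> n, the integer part n - i is nonnegative, so the triangle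
      inequality compares the two products factor by factor.\<close>
    have "of_nat n + a - of_nat i = of_nat (n - i) + a"
      using i assms by (simp add: of_nat_diff)
    also have "norm \<dots> \<le> real (n - i) + norm a"
      by (metis norm_triangle_ineq norm_of_nat)
    finally show "norm (of_nat n + a - of_nat i) \<le> real n + norm a - real i"
      using i assms by (simp add: of_nat_diff)
  qed auto
  finally show ?thesis by (simp add: gbinomial_prod_rev)
qed

text \<open>Replacing the order by its modulus and y by -|y| makes every term nonnegative. The
  majorant is thus again a Laguerre polynomial, so its generating function is known in closed form;
  the first claim records that it is real.\<close>

lemma laguerre_majorant:
  "laguerre n (of_real (norm \<alpha>)) (-\<bar>y\<bar>) = of_real (Re (laguerre n (of_real (norm \<alpha>)) (-\<bar>y\<bar>)))"
  "norm (laguerre n \<alpha> y) \<le> Re (laguerre n (of_real (norm \<alpha>)) (-\<bar>y\<bar>))"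
proof -
  have eq: "laguerre n (of_real (norm \<alpha>)) (-\<bar>y\<bar>) =
      of_real (\<Sum>k\<le>n. 1 / fact k * ((real n + norm \<alpha>) gchoose (n - k)) * \<bar>y\<bar> ^ k)"
    unfolding laguerre_def of_real_sum
  proof (intro sum.cong refl)
    fix k
    have "complex_of_real (real n + norm \<alpha>) gchoose (n - k) = of_real ((real n + norm \<alpha>) gchoose (n - k))"
      by (simp add: gbinomial_prod_rev)
    moreover have "(-1) ^ k * complex_of_real (- \<bar>y\<bar>) ^ k = of_real (\<bar>y\<bar> ^ k)"
      by (simp flip: power_mult_distrib)
    ultimately show "(- 1) ^ k / of_nat (fact k) * (of_nat n + complex_of_real (cmod \<alpha>) gchoose n - k) *
         complex_of_real (- \<bar>y\<bar>) ^ k =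
         complex_of_real (1 / fact k * (real n + cmod \<alpha> gchoose n - k) * \<bar>y\<bar> ^ k)"
      by (simp add: field_simps)
  qed
  then show "laguerre n (of_real (norm \<alpha>)) (-\<bar>y\<bar>) = of_real (Re (laguerre n (of_real (norm \<alpha>)) (-\<bar>y\<bar>)))"
    by (simp only: Re_complex_of_real)
  have "norm (laguerre n \<alpha> y) \<le>
      (\<Sum>k\<le>n. 1 / fact k * ((real n + norm \<alpha>) gchoose (n - k)) * \<bar>y\<bar> ^ k)"
    unfolding laguerre_def
  proof (intro order_trans[OF norm_sum] sum_mono)
    fix k
    show "norm ((-1) ^ k / of_nat (fact k) * ((of_nat n + \<alpha>) gchoose (n - k)) * of_real y ^ k) \<le>
        1 / fact k * ((real n + norm \<alpha>) gchoose (n - k)) * \<bar>y\<bar> ^ k"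
      using norm_gbinomial_le[of "n - k" n \<alpha>]
      by (auto simp: norm_mult norm_divide norm_power intro!: mult_right_mono divide_right_mono)
  qed
  then show "norm (laguerre n \<alpha> y) \<le> Re (laguerre n (of_real (norm \<alpha>)) (-\<bar>y\<bar>))"
    by (simp only: eq Re_complex_of_real)
qed

text \<open>The nonnegative majorant series is summed exactly by the generating function at the real
  point r. The bound does not depend on N, as dominated convergence requires.\<close>

lemma laguerre_partial_sum_bound:
  assumes r: "0 \<le> r" "r < 1" and t: "norm t \<le> r"
  shows "(\<Sum>n<N. norm (laguerre n \<alpha> y * t ^ n)) \<le> (1 - r) powr (- norm \<alpha> - 1) * exp (r * \<bar>y\<bar> / (1 - r))"
proof -
  let ?m = "\<lambda>n. Re (laguerre n (of_real (norm \<alpha>)) (-\<bar>y\<bar>))"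
  have m0: "?m n \<ge> 0" for n
    using laguerre_majorant(2)[of n \<alpha> y] norm_ge_zero order_trans by blast
  have "(\<lambda>n. laguerre n (of_real (norm \<alpha>)) (-\<bar>y\<bar>) * of_real r ^ n) sums
      ((1 - of_real r) powr (- of_real (norm \<alpha>) - 1) * exp (- (of_real r * of_real (-\<bar>y\<bar>) / (1 - of_real r))))"
    using r by (intro laguerre_sums) auto
  also have "(\<lambda>n. laguerre n (of_real (norm \<alpha>)) (-\<bar>y\<bar>) * of_real r ^ n) = (\<lambda>n. of_real (?m n * r ^ n))"
    by (subst laguerre_majorant(1)) simp
  also have "(1 - of_real r) powr (- of_real (norm \<alpha>) - 1) * exp (- (of_real r * of_real (-\<bar>y\<bar>) / (1 - of_real r))) =
      complex_of_real ((1 - r) powr (- norm \<alpha> - 1) * exp (r * \<bar>y\<bar> / (1 - r)))"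
    using r powr_of_real[of "1 - r" "- norm \<alpha> - 1"] by (simp flip: exp_of_real)
  finally have sums: "(\<lambda>n. ?m n * r ^ n) sums ((1 - r) powr (- norm \<alpha> - 1) * exp (r * \<bar>y\<bar> / (1 - r)))"
    by (simp only: sums_of_real_iff)
  have "(\<Sum>n<N. norm (laguerre n \<alpha> y * t ^ n)) \<le> (\<Sum>n<N. ?m n * r ^ n)"
    unfolding norm_mult norm_power
    by (intro sum_mono mult_mono laguerre_majorant power_mono t m0) auto
  also have "\<dots> \<le> (\<Sum>n. ?m n * r ^ n)"
    using sums r m0 by (intro sum_le_suminf) (auto simp: sums_iff)
  finally show ?thesis using sums by (simp add: sums_iff)
qed

lemma continuous_on_laguerre [continuous_intros]: "continuous_on A (laguerre n \<alpha>)"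
  unfolding laguerre_def by (intro continuous_intros)

lemma borel_measurable_laguerre [measurable]: "laguerre n \<alpha> \<in> borel_measurable borel"
  by (intro borel_measurable_continuous_onI continuous_intros)

text \<open>
  The factor $1/2$ in the exponent is $r/(1-r)$ at $r = 1/3$: the majorant of the generating
  function on the disc of radius $1/3$ then serves as dominating function.
\<close>
lemma
  fixes u :: "'a \<Rightarrow> real" and w :: "'a \<Rightarrow> complex"
  assumes [measurable]: "u \<in> borel_measurable M" "w \<in> borel_measurable M"
    and int: "integrable M (\<lambda>p. exp (\<bar>u p\<bar> / 2) * norm (w p))"
  shows integrable_laguerre: "integrable M (\<lambda>p. laguerre j \<alpha> (u p) * w p)"
    and has_fps_expansion_laguerre_transform:
      "(\<lambda>t. (1 - t) powr (- \<alpha> - 1) * (\<integral>p. exp (- (t * of_real (u p) / (1 - t))) * w p \<partial>M))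
         has_fps_expansion Abs_fps (\<lambda>j. \<integral>p. laguerre j \<alpha> (u p) * w p \<partial>M)"
proof -
  define C where "C = (1 - 1 / 3 :: real) powr (- norm \<alpha> - 1)"
  have bound: "(\<Sum>n<N. norm (laguerre n \<alpha> y * t ^ n)) \<le> C * exp (\<bar>y\<bar> / 2)"
    if "norm t \<le> 1 / 3" for t :: complex and y N
    using laguerre_partial_sum_bound[OF _ _ that, where N = N and \<alpha> = \<alpha> and y = y] by (simp add: C_def)
  have lag: "integrable M (\<lambda>p. laguerre j \<alpha> (u p) * w p)" for j
  \<comment> \<open>A single Laguerre polynomial is one term of the partial sum at t = 1/3; undoing
    the power (1/3)^j costs the factor 3^j.\<close>
  proof (rule Bochner_Integration.integrable_bound[where f = "\<lambda>p. 3 ^ j * (C * (exp (\<bar>u p\<bar> / 2) * norm (w p)))"])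
    show "AE p in M. norm (laguerre j \<alpha> (u p) * w p) \<le> norm (3 ^ j * (C * (exp (\<bar>u p\<bar> / 2) * norm (w p))))"
    proof (intro AE_I2)
      fix p
      have "norm (laguerre j \<alpha> (u p) * (1 / 3) ^ j) \<le> (\<Sum>n<Suc j. norm (laguerre n \<alpha> (u p) * (1 / 3) ^ n))"
        by (rule member_le_sum) auto
      also have "\<dots> \<le> C * exp (\<bar>u p\<bar> / 2)" by (rule bound) (simp add: norm_divide)
      finally have "norm (laguerre j \<alpha> (u p)) \<le> 3 ^ j * (C * exp (\<bar>u p\<bar> / 2))"
        by (simp add: norm_mult norm_divide norm_power power_divide field_simps)
      from mult_right_mono[OF this, of "norm (w p)"]
      show "norm (laguerre j \<alpha> (u p) * w p) \<le> norm (3 ^ j * (C * (exp (\<bar>u p\<bar> / 2) * norm (w p))))"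
        by (simp add: norm_mult mult_ac C_def)
    qed
  qed (use int in auto)
  then show "integrable M (\<lambda>p. laguerre j \<alpha> (u p) * w p)" .
  show "(\<lambda>t. (1 - t) powr (- \<alpha> - 1) * (\<integral>p. exp (- (t * of_real (u p) / (1 - t))) * w p \<partial>M))
         has_fps_expansion Abs_fps (\<lambda>j. \<integral>p. laguerre j \<alpha> (u p) * w p \<partial>M)"
  proof (rule has_fps_expansionI)
    show "\<forall>\<^sub>F t in nhds 0. (\<lambda>n. Abs_fps (\<lambda>j. \<integral>p. laguerre j \<alpha> (u p) * w p \<partial>M) $ n * t ^ n) sums
        ((1 - t) powr (- \<alpha> - 1) * (\<integral>p. exp (- (t * of_real (u p) / (1 - t))) * w p \<partial>M))"
      using eventually_norm_less_nhds_0[of "1 / 3", simplified]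
    proof eventually_elim
      case (elim t)
      have "(\<lambda>N. \<integral>p. (\<Sum>n<N. laguerre n \<alpha> (u p) * t ^ n) * w p \<partial>M) \<longlonglongrightarrow>
          (\<integral>p. (1 - t) powr (- \<alpha> - 1) * exp (- (t * of_real (u p) / (1 - t))) * w p \<partial>M)"
      proof (rule integral_dominated_convergence[where w = "\<lambda>p. C * (exp (\<bar>u p\<bar> / 2) * norm (w p))"])
        show "AE p in M. (\<lambda>N. (\<Sum>n<N. laguerre n \<alpha> (u p) * t ^ n) * w p) \<longlonglongrightarrow>
            (1 - t) powr (- \<alpha> - 1) * exp (- (t * of_real (u p) / (1 - t))) * w p"
          using elim by (intro AE_I2 tendsto_mult_right laguerre_sums[unfolded sums_def]) auto
        show "AE p in M. norm ((\<Sum>n<N. laguerre n \<alpha> (u p) * t ^ n) * w p) \<le>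
            C * (exp (\<bar>u p\<bar> / 2) * norm (w p))" for N
        proof (intro AE_I2)
          fix p
          have "norm (\<Sum>n<N. laguerre n \<alpha> (u p) * t ^ n) \<le> C * exp (\<bar>u p\<bar> / 2)"
            using elim by (intro order_trans[OF norm_sum bound]) auto
          from mult_right_mono[OF this, of "norm (w p)"]
          show "norm ((\<Sum>n<N. laguerre n \<alpha> (u p) * t ^ n) * w p) \<le> C * (exp (\<bar>u p\<bar> / 2) * norm (w p))"
            by (simp add: norm_mult mult_ac)
        qed
      qed (use int in auto)
      also have "(\<lambda>N. \<integral>p. (\<Sum>n<N. laguerre n \<alpha> (u p) * t ^ n) * w p \<partial>M) =
          (\<lambda>N. \<Sum>n<N. (\<integral>p. laguerre n \<alpha> (u p) * w p \<partial>M) * t ^ n)"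
      proof
        fix N
        have "(\<integral>p. (\<Sum>n<N. laguerre n \<alpha> (u p) * t ^ n) * w p \<partial>M) =
            (\<integral>p. (\<Sum>n<N. (laguerre n \<alpha> (u p) * w p) * t ^ n) \<partial>M)"
          by (simp add: sum_distrib_right mult.assoc mult.commute[of "w _"])
        also have "\<dots> = (\<Sum>n<N. (\<integral>p. (laguerre n \<alpha> (u p) * w p) * t ^ n \<partial>M))"
          by (intro Bochner_Integration.integral_sum integrable_mult_left lag)
        finally show "(\<integral>p. (\<Sum>n<N. laguerre n \<alpha> (u p) * t ^ n) * w p \<partial>M) =
            (\<Sum>n<N. (\<integral>p. laguerre n \<alpha> (u p) * w p \<partial>M) * t ^ n)" by simp
      qed
      finally show ?case by (simp add: sums_def mult.assoc)
    qed
  qed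
qed

section \<open>Poisson integral of the modified Bessel function of the first kind\<close>

lemma borel_measurable_of_real_powr [measurable (raw)]:
  assumes [measurable]: "f \<in> borel_measurable M"
  shows "(\<lambda>x. complex_of_real (f x) powr a) \<in> borel_measurable M"
proof -
  have "complex_of_real s powr a = (if s = 0 then 0 else if s > 0 then exp (a * of_real (ln s))
          else exp (a * (of_real (ln (- s)) + \<i> * of_real pi)))" for s :: real
    using Ln_minus[of "of_real (- s)"]
    by (auto simp: powr_def Ln_of_real simp flip: of_real_minus)
  then show ?thesis by simp
qed

lemma borel_measurable_cosh [measurable (raw)]:
  fixes f :: "'a \<Rightarrow> real"
  shows "f \<in> borel_measurable M \<Longrightarrow> (\<lambda>x. cosh (f x)) \<in> borel_measurable M"
  by (rule borel_measurable_continuous_on[rotated]) (auto intro!: continuous_intros)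

lemma borel_measurable_sinh [measurable (raw)]:
  fixes f :: "'a \<Rightarrow> real"
  shows "f \<in> borel_measurable M \<Longrightarrow> (\<lambda>x. sinh (f x)) \<in> borel_measurable M"
  by (rule borel_measurable_continuous_on[rotated]) (auto intro!: continuous_intros)

section \<open>Gamma, Gaussian and Beta integrals\<close>

lemma Gamma_nonzero_Re_pos:
  assumes "Re z > 0"
  shows "Gamma z \<noteq> 0"
proof
  assume "Gamma z = 0"
  then obtain n where "z = of_int n" "n \<le> 0"
    by (auto simp: Gamma_eq_zero_iff elim: nonpos_Ints_cases)
  with assms show False by simp
qed

lemma has_bochner_integral_Gamma:
  assumes a: "Re a > 0" and c: "c > 0"
  shows "has_bochner_integral lborel
    (\<lambda>s. indicator {0<..} s *\<^sub>R (complex_of_real s powr (a - 1) * of_real (exp (- (c * s)))))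
    (Gamma a * of_real c powr (- a))"
proof -
  let ?f = "\<lambda>s. indicator {0<..} s *\<^sub>R (complex_of_real s powr (a - 1) * of_real (exp (- s)))"
  have "set_integrable lebesgue {0<..} (\<lambda>t. complex_of_real t powr (a - 1) / of_real (exp t))"
    using absolutely_integrable_Gamma_integral'[OF a] .
  then have "set_integrable lebesgue {0<..} (\<lambda>t. complex_of_real t powr (a - 1) * of_real (exp (- t)))"
    by (simp add: exp_minus divide_inverse)
  then have int: "set_integrable lborel {0<..} (\<lambda>t. complex_of_real t powr (a - 1) * of_real (exp (- t)))"
    unfolding set_integrable_def by (subst (asm) integrable_completion) auto
  have "((\<lambda>t. of_real t powr (a - 1) * of_real (exp (- t))) has_integral Gamma a) {0<..}"
    using Gamma_integral_complex'[OF a] by (simp add: exp_minus divide_inverse)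
  then have "(LINT t:{0<..}|lborel. complex_of_real t powr (a - 1) * of_real (exp (- t))) = Gamma a"
    using set_borel_integral_eq_integral(2)[OF int] by (simp add: integral_unique)
  with int have "has_bochner_integral lborel ?f (Gamma a)"
    by (simp add: has_bochner_integral_iff set_integrable_def set_lebesgue_integral_def)
  then have "has_bochner_integral lborel (\<lambda>s. ?f (0 + c * s)) (Gamma a /\<^sub>R \<bar>c\<bar>)"
    using c by (subst (asm) lborel_has_bochner_integral_real_affine_iff[of c _ _ 0]) auto
  \<comment> \<open>After the substitution cs for s, the integrand carries c^(a-1) and the value
    1/c. Multiplying by c^(1-a) removes the former and turns the latter into c^(-a).\<close>
  then have "has_bochner_integral lborel (\<lambda>s. of_real c powr (1 - a) * ?f (0 + c * s))
      (of_real c powr (1 - a) * (Gamma a /\<^sub>R \<bar>c\<bar>))"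
    by (rule has_bochner_integral_mult_right)
  also have "(\<lambda>s. of_real c powr (1 - a) * ?f (0 + c * s)) =
      (\<lambda>s. indicator {0<..} s *\<^sub>R (complex_of_real s powr (a - 1) * of_real (exp (- (c * s)))))"
  proof
    fix s
    have "complex_of_real c powr (1 - a) * (complex_of_real (c * s) powr (a - 1)) =
        complex_of_real s powr (a - 1)" if "s > 0"
      using that c powr_add[of "complex_of_real c" "1 - a" "a - 1"]
      by (simp add: powr_times_real)
    then show "of_real c powr (1 - a) * ?f (0 + c * s) =
        indicator {0<..} s *\<^sub>R (complex_of_real s powr (a - 1) * of_real (exp (- (c * s))))"
      using c by (auto simp: indicator_def zero_less_mult_iff)
  qed
  also have "of_real c powr (1 - a) * (Gamma a /\<^sub>R \<bar>c\<bar>) = Gamma a * of_real c powr (- a)"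
    using c by (simp add: powr_diff powr_minus scaleR_conv_of_real field_simps)
  finally show ?thesis .
qed

lemma has_bochner_integral_Gamma_real:
  fixes a c :: real
  assumes "a > 0" "c > 0"
  shows "has_bochner_integral lborel (\<lambda>s. indicator {0<..} s *\<^sub>R (s powr (a - 1) * exp (- (c * s))))
    (Gamma a * c powr (- a))"
proof -
  have "has_bochner_integral lborel (\<lambda>s. complex_of_real (indicator {0<..} s *\<^sub>R (s powr (a - 1) * exp (- (c * s)))))
    (complex_of_real (Gamma a * c powr (- a)))"
    using has_bochner_integral_Gamma[of "of_real a" c] assms
    by (subst has_bochner_integral_cong[OF refl _ refl])
       (auto simp: indicator_def powr_Reals_eq Gamma_complex_of_real scaleR_conv_of_real)
  from has_bochner_integral_Re[OF this] show ?thesis by (simp only: Re_complex_of_real)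
qed

lemma has_bochner_integral_gaussian_moment:
  fixes s :: real
  assumes s: "s > 0"
  shows "has_bochner_integral lborel (\<lambda>y. exp (- (s * y\<^sup>2)) * y ^ (2 * m))
    (sqrt pi * fact (2 * m) / (4 ^ m * fact m) * s powr (- real m - 1 / 2))"
proof -
  \<comment> \<open>The variance 1/(2s) makes the normal density proportional to exp(-s y^2); the
    factor sqrt(pi/s) below undoes its normalisation.\<close>
  define \<sigma> where "\<sigma> = 1 / sqrt (2 * s)"
  have \<sigma>: "\<sigma> > 0" "\<sigma>\<^sup>2 = 1 / (2 * s)" using s by (auto simp: \<sigma>_def power_divide)
  have int: "has_bochner_integral lborel (\<lambda>y. sqrt (pi / s) * (normal_density 0 \<sigma> y * (y - 0) ^ (2 * m)))
      (sqrt (pi / s) * (fact (2 * m) / ((2 / \<sigma>\<^sup>2) ^ m * fact m)))"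
    by (intro has_bochner_integral_mult_right normal_moment_even \<sigma>)
  have "2 * pi * \<sigma>\<^sup>2 = pi / s" "- (y - 0)\<^sup>2 / (2 * \<sigma>\<^sup>2) = - (s * y\<^sup>2)" for y
    using s by (simp_all add: \<sigma>)
  then have "normal_density 0 \<sigma> y = 1 / sqrt (pi / s) * exp (- (s * y\<^sup>2))" for y
    unfolding normal_density_def by simp
  then have eq1: "sqrt (pi / s) * (normal_density 0 \<sigma> y * (y - 0) ^ (2 * m)) = exp (- (s * y\<^sup>2)) * y ^ (2 * m)" for y
    using s by simp
  have "s powr (- real m - 1 / 2) = inverse (s powr real m) * inverse (s powr (1 / 2))"
    using powr_add[of s "- real m" "- (1 / 2)"] by (simp only: powr_minus diff_conv_add_uminus)
  then have "s powr (- real m - 1 / 2) = 1 / (s ^ m * sqrt s)"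
    using s by (simp only: powr_realpow powr_half_sqrt less_imp_le) (simp add: field_simps)
  moreover have "2 / \<sigma>\<^sup>2 = 4 * s" by (simp add: \<sigma>)
  ultimately have eq2: "sqrt (pi / s) * (fact (2 * m) / ((2 / \<sigma>\<^sup>2) ^ m * fact m)) =
      sqrt pi * fact (2 * m) / (4 ^ m * fact m) * s powr (- real m - 1 / 2)"
    by (simp only: power_mult_distrib real_sqrt_divide) simp
  show ?thesis using int unfolding eq1 eq2 .
qed

lemma integrable_cmult_cancel:
  fixes c :: complex
  assumes "integrable M (\<lambda>x. c * h x)" "c \<noteq> 0"
  shows "integrable M h"
proof -
  have "integrable M (\<lambda>x. inverse c * (c * h x))"
    using assms(1) by (rule integrable_mult_right)
  moreover have "inverse c * (c * h x) = h x" for x using assms(2) by simp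
  ultimately show ?thesis by (simp only:)
qed

text \<open>The integral of s^(m + \<mu>/2) exp(-s(1 + y^2)) y^(2m) over s > 0 and real y is
  evaluated in both orders. The s-integral is a Gamma integral producing the power of 1 + y^2; the
  y-integral is a Gaussian moment lowering the power of s to (\<mu> + 1)/2 - 1, which leaves
  Gamma((\<mu> + 1)/2). Integrability in y comes out of Fubini as well.\<close>

lemma has_bochner_integral_even_beta:
  assumes \<mu>: "Re \<mu> > -1"
  shows "has_bochner_integral lborel
    (\<lambda>y. of_real (y ^ (2 * m)) * complex_of_real (1 + y\<^sup>2) powr (- (of_nat m + \<mu> / 2 + 1)))
    (of_real (sqrt pi * fact (2 * m) / (4 ^ m * fact m)) * Gamma ((\<mu> + 1) / 2) * rGamma (of_nat m + \<mu> / 2 + 1))"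
proof -
  define K where "K = sqrt pi * fact (2 * m) / (4 ^ m * fact m)"
  define F where "F = (\<lambda>s y. indicator {0<..} s *\<^sub>R (complex_of_real s powr (of_nat m + \<mu> / 2)
      * of_real (exp (- s) * (exp (- (s * y\<^sup>2)) * y ^ (2 * m)))))"
  define h where "h = (\<lambda>y. of_real (y ^ (2 * m)) *
      complex_of_real (1 + y\<^sup>2) powr (- (of_nat m + \<mu> / 2 + 1)))"
  define \<Gamma> where "\<Gamma> = Gamma (of_nat m + \<mu> / 2 + 1)"
  have [measurable]: "case_prod F \<in> borel_measurable (lborel \<Otimes>\<^sub>M lborel)"
    unfolding F_def by measurable
  have normF: "norm (F s y) = indicator {0<..} s *\<^sub>R (s powr (real m + Re \<mu> / 2) * exp (- s)) *
      (exp (- (s * y\<^sup>2)) * y ^ (2 * m))" for s y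
    by (auto simp: F_def indicator_def norm_mult norm_powr_real_powr norm_power power_mult)
  have in_y: "has_bochner_integral lborel (\<lambda>y. F s y)
      (indicator {0<..} s *\<^sub>R (complex_of_real s powr (of_nat m + \<mu> / 2) *
         of_real (exp (- s) * (K * s powr (- real m - 1 / 2)))))" for s
  proof (cases "s > 0")
    case True
    then show ?thesis unfolding F_def K_def
      by (intro has_bochner_integral_scaleR_right has_bochner_integral_mult_right
          has_bochner_integral_of_real has_bochner_integral_gaussian_moment)
  qed (simp add: F_def has_bochner_integral_zero)
  have prod: "integrable (lborel \<Otimes>\<^sub>M lborel) (case_prod F)"
  proof (rule lborel_pair.Fubini_integrable)
    have "(\<integral>y. norm (F s y) \<partial>lborel) =
        K * (indicator {0<..} s *\<^sub>R (s powr ((Re \<mu> + 1) / 2 - 1) * exp (- (1 * s))))" for s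
    proof (cases "s > 0")
      case True
      have "s powr ((Re \<mu> + 1) / 2 - 1) = s powr (real m + Re \<mu> / 2) * s powr (- real m - 1 / 2)"
        by (simp add: field_simps flip: powr_add)
      then show ?thesis using True has_bochner_integral_integral_eq[OF has_bochner_integral_gaussian_moment[OF True, of m]]
        by (simp add: normF K_def)
    qed (simp add: normF)
    moreover have "integrable lborel (\<lambda>s. K * (indicator {0<..} s *\<^sub>R (s powr ((Re \<mu> + 1) / 2 - 1) * exp (- (1 * s)))))"
      using \<mu> by (intro integrable_mult_right integrable.intros[OF has_bochner_integral_Gamma_real]) auto
    ultimately show "integrable lborel (\<lambda>s. \<integral>y. norm (case (s, y) of (s, y) \<Rightarrow> F s y) \<partial>lborel)"
      by (simp only: prod.case)
    show "AE s in lborel. integrable lborel (\<lambda>y. case (s, y) of (s, y) \<Rightarrow> F s y)"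
      using integrable.intros[OF in_y] by simp
  qed simp
  have in_s: "(\<integral>s. F s y \<partial>lborel) = \<Gamma> * h y" for y
  proof -
    have pos: "1 + y\<^sup>2 > 0" by (simp add: add_pos_nonneg)
    have e: "exp (- ((1 + y\<^sup>2) * s)) = exp (- s) * exp (- (s * y\<^sup>2))" for s
      by (simp add: algebra_simps flip: exp_add)
    have "has_bochner_integral lborel (\<lambda>s. of_real (y ^ (2 * m)) * (indicator {0<..} s *\<^sub>R
        (complex_of_real s powr ((of_nat m + \<mu> / 2 + 1) - 1) * of_real (exp (- ((1 + y\<^sup>2) * s))))))
        (of_real (y ^ (2 * m)) * (Gamma (of_nat m + \<mu> / 2 + 1) * of_real (1 + y\<^sup>2) powr (- (of_nat m + \<mu> / 2 + 1))))"
      using \<mu> pos by (intro has_bochner_integral_mult_right has_bochner_integral_Gamma) auto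
    moreover have "of_real (y ^ (2 * m)) * (indicator {0<..} s *\<^sub>R
        (complex_of_real s powr ((of_nat m + \<mu> / 2 + 1) - 1) * of_real (exp (- ((1 + y\<^sup>2) * s))))) =
        F s y" for s
      unfolding F_def e by (cases "s > 0") (simp_all only: indicator_simps greaterThan_iff scaleR_one
          of_real_mult add_diff_cancel_right' mult_ac, simp_all)
    ultimately show ?thesis by (simp only: has_bochner_integral_iff \<Gamma>_def h_def mult_ac)
  qed
  have G: "\<Gamma> \<noteq> 0"
    using \<mu> unfolding \<Gamma>_def by (intro Gamma_nonzero_Re_pos) simp
  have "integrable lborel (\<lambda>y. \<integral>s. F s y \<partial>lborel)"
    by (rule lborel_pair.integrable_snd[OF prod])
  then have int: "integrable lborel h"
    unfolding in_s by (rule integrable_cmult_cancel[OF _ G])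
  have eq: "(\<integral>y. F s y \<partial>lborel) = of_real K * (indicator {0<..} s *\<^sub>R
        (complex_of_real s powr ((\<mu> + 1) / 2 - 1) * of_real (exp (- (1 * s)))))" for s
  proof (cases "s > 0")
    case True
    have "complex_of_real (s powr (- real m - 1 / 2)) = complex_of_real s powr (- of_nat m - 1 / 2)"
      using True powr_of_real[of s "- real m - 1 / 2"] by simp
    moreover have "complex_of_real s powr ((\<mu> + 1) / 2 - 1) =
        complex_of_real s powr (of_nat m + \<mu> / 2) * complex_of_real s powr (- of_nat m - 1 / 2)"
      by (simp add: add_divide_distrib flip: powr_add)
    ultimately show ?thesis
      using True has_bochner_integral_integral_eq[OF in_y[of s]] by simp
  qed (simp add: F_def)
  have "\<Gamma> * integral\<^sup>L lborel h = (\<integral>y. (\<integral>s. F s y \<partial>lborel) \<partial>lborel)"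
    unfolding in_s using int by simp
  also have "\<dots> = (\<integral>s. (\<integral>y. F s y \<partial>lborel) \<partial>lborel)"
    by (rule lborel_pair.Fubini_integral[OF prod])
  also have "\<dots> = of_real K * (Gamma ((\<mu> + 1) / 2) * of_real 1 powr (- ((\<mu> + 1) / 2)))"
    unfolding eq using \<mu>
    by (intro has_bochner_integral_integral_eq has_bochner_integral_mult_right has_bochner_integral_Gamma) auto
  also have "\<dots> = of_real K * Gamma ((\<mu> + 1) / 2)" by simp
  finally have "integral\<^sup>L lborel h = of_real K * Gamma ((\<mu> + 1) / 2) * inverse \<Gamma>"
    using G by (metis mult.commute nonzero_mult_div_cancel_left divide_inverse)
  with int have "has_bochner_integral lborel h (of_real K * Gamma ((\<mu> + 1) / 2) * inverse \<Gamma>)"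
    by (simp add: has_bochner_integral_iff)
  then show ?thesis by (simp only: h_def K_def \<Gamma>_def rGamma_inverse_Gamma)
qed

text \<open>For complex f, substitution needs integrability on both sides. The nonnegative version
  applied to norms transfers it from the x-side to the image interval; then the general version
  applies.\<close>

lemma
  fixes f :: "real \<Rightarrow> complex" and g g' :: "real \<Rightarrow> real" and a b A B :: ereal
  assumes "a < b"
    and deriv_g: "\<And>x. a < ereal x \<Longrightarrow> ereal x < b \<Longrightarrow> DERIV g x :> g' x"
    and contf: "\<And>x. a < ereal x \<Longrightarrow> ereal x < b \<Longrightarrow> isCont f (g x)"
    and contg': "\<And>x. a < ereal x \<Longrightarrow> ereal x < b \<Longrightarrow> isCont g' x"
    and g'_nonneg: "\<And>x. a \<le> ereal x \<Longrightarrow> ereal x \<le> b \<Longrightarrow> 0 \<le> g' x"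
    and A: "((ereal \<circ> g \<circ> real_of_ereal) \<longlongrightarrow> A) (at_right a)"
    and B: "((ereal \<circ> g \<circ> real_of_ereal) \<longlongrightarrow> B) (at_left b)"
    and [measurable]: "f \<in> borel_measurable borel"
    and int: "set_integrable lborel (einterval a b) (\<lambda>x. g' x *\<^sub>R f (g x))"
  shows set_integrable_substitution: "set_integrable lborel (einterval A B) f"
    and interval_integral_substitution: "(LBINT x=A..B. f x) = (LBINT x=a..b. g' x *\<^sub>R f (g x))"
proof -
  have "set_integrable lborel (einterval a b) (\<lambda>x. norm (g' x *\<^sub>R f (g x)))"
    using int by (rule set_integrable_norm)
  also have "?this \<longleftrightarrow> set_integrable lborel (einterval a b) (\<lambda>x. norm (f (g x)) * g' x)"
    by (intro set_integrable_cong) (auto simp: einterval_def g'_nonneg less_imp_le)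
  finally have "set_integrable lborel (einterval A B) (\<lambda>x. norm (f x))"
    by (intro interval_integral_substitution_nonneg(1)[OF assms(1) deriv_g _ contg' _ g'_nonneg A B])
       (auto intro!: continuous_intros contf)
  then show *: "set_integrable lborel (einterval A B) f"
    unfolding set_integrable_def by (rule Bochner_Integration.integrable_bound) auto
  show "(LBINT x=A..B. f x) = (LBINT x=a..b. g' x *\<^sub>R f (g x))"
    by (rule interval_integral_substitution_integrable[OF assms(1) deriv_g contf contg' g'_nonneg A B int *])
qed

lemma of_real_powr_powr:
  fixes a b :: real
  assumes "a > 0"
  shows "complex_of_real (a powr b) powr c = complex_of_real a powr (of_real b * c)"
proof -
  have "complex_of_real (a powr b) = exp (of_real b * of_real (ln a))"
    using assms by (simp add: powr_def exp_of_real[symmetric])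
  moreover have "Ln (exp (of_real b * of_real (ln a))) = of_real b * of_real (ln a)"
    by (rule Ln_exp) auto
  ultimately show ?thesis
    using assms by (simp add: powr_def Ln_of_real mult_ac)
qed

text \<open>The substitution \<theta> = arctan y + pi/2 maps the line onto (0, pi), with sin
  \<theta> = (1 + y^2)^(-1/2) and cos^2 \<theta> = y^2/(1 + y^2). The result is the integral of
  \<open>has_bochner_integral_even_beta\<close>.\<close>

lemma has_bochner_integral_cos_sin_powr:
  assumes \<mu>: "Re \<mu> > -1"
  shows "has_bochner_integral lborel
    (\<lambda>\<theta>. indicator {0..pi} \<theta> *\<^sub>R (of_real (cos \<theta> ^ (2 * m)) * complex_of_real (sin \<theta>) powr \<mu>))
    (of_real (sqrt pi * fact (2 * m) / (4 ^ m * fact m)) * Gamma ((\<mu> + 1) / 2) * rGamma (of_nat m + \<mu> / 2 + 1))"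
proof -
  let ?f = "\<lambda>\<theta>. of_real (cos \<theta> ^ (2 * m)) * complex_of_real (sin \<theta>) powr \<mu>"
  let ?g = "\<lambda>y. arctan y + pi / 2" and ?g' = "\<lambda>y::real. inverse (1 + y\<^sup>2)"
  have eq: "?g' y *\<^sub>R ?f (?g y) =
      of_real (y ^ (2 * m)) * complex_of_real (1 + y\<^sup>2) powr (- (of_nat m + \<mu> / 2 + 1))" for y
  proof -
    have pos: "1 + y\<^sup>2 > 0" by (simp add: add_pos_nonneg)
    have c: "cos (?g y) ^ (2 * m) = y ^ (2 * m) * (1 + y\<^sup>2) powr (- real m)"
    proof -
      have "cos (?g y) ^ 2 = y ^ 2 / (1 + y ^ 2)"
        using pos by (simp add: cos_add sin_arctan power_divide)
      then show ?thesis
        using pos by (simp only: power_mult power_divide powr_minus_divide powr_realpow times_divide_eq_right mult_1_right)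
    qed
    have s: "sin (?g y) = (1 + y\<^sup>2) powr (- (1 / 2))"
      using pos by (simp add: sin_add cos_arctan powr_minus_divide powr_half_sqrt)
    define A where "A = 1 + y\<^sup>2"
    have A: "A > 0" using pos by (simp add: A_def)
    have "complex_of_real (sin (?g y)) powr \<mu> = of_real A powr (- (\<mu> / 2))"
      unfolding s using of_real_powr_powr[OF A, of "- (1 / 2)" \<mu>] by (simp add: A_def)
    moreover have "complex_of_real (A powr (- real m)) = of_real A powr (- of_nat m)"
      using A powr_of_real[of A "- real m"] by simp
    moreover have "complex_of_real (inverse A) = of_real A powr (- 1)"
      using A by (simp add: powr_minus)
    moreover have "complex_of_real A powr (- (of_nat m + \<mu> / 2 + 1)) =
       complex_of_real A powr (- of_nat m) * complex_of_real A powr (- (\<mu> / 2)) * complex_of_real A powr (- 1)"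
      by (simp flip: powr_add)
    ultimately show ?thesis
      unfolding c scaleR_conv_of_real A_def[symmetric] of_real_mult by (simp only: mult_ac)
  qed
  have int: "has_bochner_integral lborel (\<lambda>y. ?g' y *\<^sub>R ?f (?g y))
    (of_real (sqrt pi * fact (2 * m) / (4 ^ m * fact m)) * Gamma ((\<mu> + 1) / 2) * rGamma (of_nat m + \<mu> / 2 + 1))"
    unfolding eq by (rule has_bochner_integral_even_beta[OF \<mu>])
  have lim1: "((ereal \<circ> ?g \<circ> real_of_ereal) \<longlongrightarrow> ereal 0) (at_right (-\<infinity>))"
    using tendsto_add[OF tendsto_arctan_at_bot tendsto_const[of "pi / 2"]] by (simp add: ereal_tendsto_simps)
  have lim2: "((ereal \<circ> ?g \<circ> real_of_ereal) \<longlongrightarrow> ereal pi) (at_left \<infinity>)"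
    using tendsto_add[OF tendsto_arctan_at_top tendsto_const[of "pi / 2"]] by (simp add: ereal_tendsto_simps)
  have cont: "isCont ?f (?g y)" for y
  proof -
    have "sin (?g y) > 0"
      by (simp add: sin_add cos_arctan add_pos_nonneg)
    then show ?thesis by (intro continuous_intros) (simp add: complex_nonpos_Reals_iff)
  qed
  have pos: "1 + y\<^sup>2 > 0" for y :: real by (simp add: add_pos_nonneg)
  have deriv: "DERIV ?g y :> ?g' y" for y
    using DERIV_add[OF DERIV_arctan[of y] DERIV_const[of "pi / 2"]] by simp
  have cont': "isCont ?g' y" for y
    using pos[of y] by (intro continuous_intros) simp
  have nonneg: "0 \<le> ?g' y" for y
    using pos[of y] by simp
  have meas: "?f \<in> borel_measurable borel" by measurable
  have UNIV: "einterval (-\<infinity>) \<infinity> = UNIV" by (simp add: einterval_def)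
  have int': "set_integrable lborel (einterval (-\<infinity>) \<infinity>) (\<lambda>y. ?g' y *\<^sub>R ?f (?g y))"
    using integrable.intros[OF int] unfolding set_integrable_def UNIV by simp
  note subst = _ deriv cont cont' nonneg lim1 lim2 meas int'
  have sub1: "set_integrable lborel (einterval (ereal 0) (ereal pi)) ?f"
    by (rule set_integrable_substitution[OF subst]) simp
  have "(LBINT x=ereal 0..ereal pi. ?f x) = (LBINT x=-\<infinity>..\<infinity>. ?g' x *\<^sub>R ?f (?g x))"
    by (rule interval_integral_substitution[OF subst]) simp
  also have "\<dots> = (\<integral>x. ?g' x *\<^sub>R ?f (?g x) \<partial>lborel)"
    by (simp only: interval_lebesgue_integral_def set_lebesgue_integral_def UNIV indicator_UNIV scaleR_one) simp
  also have "\<dots> = of_real (sqrt pi * fact (2 * m) / (4 ^ m * fact m)) * Gamma ((\<mu> + 1) / 2) *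
      rGamma (of_nat m + \<mu> / 2 + 1)"
    using int by (rule has_bochner_integral_integral_eq)
  finally have sub2: "(LBINT x=ereal 0..ereal pi. ?f x) =
      of_real (sqrt pi * fact (2 * m) / (4 ^ m * fact m)) * Gamma ((\<mu> + 1) / 2) * rGamma (of_nat m + \<mu> / 2 + 1)" .
  \<comment> \<open>Closed and open interval agree even pointwise: at both endpoints the sine
    vanishes and \<open>0 powr \<mu> = 0\<close>.\<close>
  have ind: "indicator {0..pi} \<theta> *\<^sub>R ?f \<theta> = indicator (einterval (ereal 0) (ereal pi)) \<theta> *\<^sub>R ?f \<theta>" for \<theta>
    by (cases "\<theta> = 0"; cases "\<theta> = pi") (auto simp: einterval_def indicator_def)
  show ?thesis
    unfolding ind has_bochner_integral_iff using sub1 sub2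
    by (simp only: set_integrable_def interval_lebesgue_integral_def set_lebesgue_integral_def) simp
qed

lemma sin_powr_set_integrable:
  assumes "Re \<mu> > -1"
  shows "set_integrable lborel {0..pi} (\<lambda>\<theta>. complex_of_real (sin \<theta>) powr \<mu>)"
  using has_bochner_integral_cos_sin_powr[OF assms, of 0] by (simp add: has_bochner_integral_iff set_integrable_def)

text \<open>The reflection \<theta> to pi - \<theta> fixes the sine and changes the sign of an odd
  power of the cosine.\<close>

lemma integral_cos_odd_sin_powr:
  "(LINT \<theta>:{0..pi}|lborel. of_real (cos \<theta> ^ (2 * m + 1)) * complex_of_real (sin \<theta>) powr \<mu>) = 0" (is "?I = 0")
proof -
  have "?I = (\<integral>\<theta>. indicator {0..pi} (pi + -1 * \<theta>) *\<^sub>R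
      (of_real (cos (pi + -1 * \<theta>) ^ (2 * m + 1)) * complex_of_real (sin (pi + -1 * \<theta>)) powr \<mu>) \<partial>lborel)"
    unfolding set_lebesgue_integral_def by (subst lborel_integral_real_affine[where c = "-1" and t = pi]) auto
  also have "\<dots> = (\<integral>\<theta>. - (indicator {0..pi} \<theta> *\<^sub>R
      (of_real (cos \<theta> ^ (2 * m + 1)) * complex_of_real (sin \<theta>) powr \<mu>)) \<partial>lborel)"
    by (intro Bochner_Integration.integral_cong refl) (auto simp: indicator_def)
  also have "\<dots> = - ?I" by (simp add: set_lebesgue_integral_def)
  finally show ?thesis by (simp add: complex_eq_iff)
qed

text \<open>The exponential series is integrated termwise, dominated by exp(|z|) times the weight.
  Odd moments vanish; in the even ones the factor (2m)!/(4^m m!) cancels the (2m)! of the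
  exponential and leaves (z/2)^(2m)/m!. The sign in exp(-z cos \<theta>) is chosen to match the
  Laguerre kernel.\<close>

lemma bessel_I_norm_Poisson:
  assumes \<mu>: "Re \<mu> > -1"
  shows "bessel_I_norm (\<mu> / 2) z = 1 / (of_real (sqrt pi) * Gamma ((\<mu> + 1) / 2)) *
    (LINT \<theta>:{0..pi}|lborel. exp (- (z * of_real (cos \<theta>))) * complex_of_real (sin \<theta>) powr \<mu>)"
proof -
  define w where "w = (\<lambda>\<theta>. indicator {0..pi} \<theta> *\<^sub>R (complex_of_real (sin \<theta>) powr \<mu>))"
  have w: "integrable lborel w"
    using sin_powr_set_integrable[OF \<mu>] by (simp add: w_def set_integrable_def)
  have [measurable]: "w \<in> borel_measurable borel" unfolding w_def by measurable
  define c where "c = (\<lambda>n. \<integral>\<theta>. of_real (cos \<theta> ^ n) * w \<theta> \<partial>lborel)"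
  have cw: "integrable lborel (\<lambda>\<theta>. complex_of_real (cos \<theta> ^ n) * w \<theta>)" for n
  proof (rule Bochner_Integration.integrable_bound[OF w])
    show "AE \<theta> in lborel. norm (complex_of_real (cos \<theta> ^ n) * w \<theta>) \<le> norm (w \<theta>)"
      by (intro AE_I2) (simp add: norm_mult norm_power mult_left_le_one_le power_le_one)
  qed auto
  have even: "c (2 * m) = of_real (sqrt pi * fact (2 * m) / (4 ^ m * fact m)) * Gamma ((\<mu> + 1) / 2) *
      rGamma (of_nat m + \<mu> / 2 + 1)" for m
    using has_bochner_integral_integral_eq[OF has_bochner_integral_cos_sin_powr[OF \<mu>, of m]]
    by (simp add: c_def w_def scaleR_conv_of_real mult_ac)
  have odd: "c (2 * m + 1) = 0" for m
    using integral_cos_odd_sin_powr[of m \<mu>] by (simp add: c_def w_def scaleR_conv_of_real mult_ac set_lebesgue_integral_def)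
  have "(\<lambda>N. \<integral>\<theta>. (\<Sum>n<N. (- (z * of_real (cos \<theta>))) ^ n /\<^sub>R fact n) * w \<theta> \<partial>lborel) \<longlonglongrightarrow>
      (\<integral>\<theta>. exp (- (z * of_real (cos \<theta>))) * w \<theta> \<partial>lborel)"
  proof (rule integral_dominated_convergence[where w = "\<lambda>\<theta>. exp (norm z) * norm (w \<theta>)"])
    show "AE \<theta> in lborel. (\<lambda>N. (\<Sum>n<N. (- (z * of_real (cos \<theta>))) ^ n /\<^sub>R fact n) * w \<theta>) \<longlonglongrightarrow>
        exp (- (z * of_real (cos \<theta>))) * w \<theta>"
      by (intro AE_I2 tendsto_mult_right exp_converges[unfolded sums_def])
    show "AE \<theta> in lborel. norm ((\<Sum>n<N. (- (z * of_real (cos \<theta>))) ^ n /\<^sub>R fact n) * w \<theta>) \<le>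
        exp (norm z) * norm (w \<theta>)" for N
    proof (intro AE_I2)
      fix \<theta>
      have "norm (\<Sum>n<N. (- (z * of_real (cos \<theta>))) ^ n /\<^sub>R fact n) \<le> (\<Sum>n<N. norm z ^ n /\<^sub>R fact n)"
      proof (intro order_trans[OF norm_sum] sum_mono)
        fix n
        have "norm z * \<bar>cos \<theta>\<bar> \<le> norm z" by (simp add: mult_left_le)
        then have "(norm z * \<bar>cos \<theta>\<bar>) ^ n \<le> norm z ^ n" by (intro power_mono) auto
        then show "norm ((- (z * of_real (cos \<theta>))) ^ n /\<^sub>R fact n) \<le> norm z ^ n /\<^sub>R fact n"
          by (simp add: norm_power norm_mult field_simps)
      qed
      also have "\<dots> \<le> exp (norm z)"
        unfolding exp_def by (intro sum_le_suminf summable_exp_generic) auto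
      finally show "norm ((\<Sum>n<N. (- (z * of_real (cos \<theta>))) ^ n /\<^sub>R fact n) * w \<theta>) \<le>
          exp (norm z) * norm (w \<theta>)"
        by (simp add: norm_mult mult_right_mono)
    qed
  qed (use w in auto)
  also have "(\<lambda>N. \<integral>\<theta>. (\<Sum>n<N. (- (z * of_real (cos \<theta>))) ^ n /\<^sub>R fact n) * w \<theta> \<partial>lborel) =
      (\<lambda>N. \<Sum>n<N. (- z) ^ n / fact n * c n)"
  proof
    fix N
    have "(- (z * of_real (cos \<theta>))) ^ n /\<^sub>R fact n = (- z) ^ n / fact n * of_real (cos \<theta> ^ n)" for n \<theta>
      using power_mult_distrib[of "- z" "of_real (cos \<theta>)" n]
      by (simp add: scaleR_conv_of_real divide_inverse mult_ac)
    then have "(\<integral>\<theta>. (\<Sum>n<N. (- (z * of_real (cos \<theta>))) ^ n /\<^sub>R fact n) * w \<theta> \<partial>lborel) =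
        (\<integral>\<theta>. (\<Sum>n<N. (- z) ^ n / fact n * (of_real (cos \<theta> ^ n) * w \<theta>)) \<partial>lborel)"
      by (simp only: sum_distrib_right mult.assoc)
    also have "\<dots> = (\<Sum>n<N. (- z) ^ n / fact n * c n)"
      unfolding c_def using cw by (simp add: Bochner_Integration.integral_sum)
    finally show "(\<integral>\<theta>. (\<Sum>n<N. (- (z * of_real (cos \<theta>))) ^ n /\<^sub>R fact n) * w \<theta> \<partial>lborel) =
        (\<Sum>n<N. (- z) ^ n / fact n * c n)" .
  qed
  finally have "(\<lambda>n. (- z) ^ n / fact n * c n) sums (\<integral>\<theta>. exp (- (z * of_real (cos \<theta>))) * w \<theta> \<partial>lborel)"
    by (simp add: sums_def)
  then have "(\<lambda>m. (- z) ^ (2 * m) / fact (2 * m) * c (2 * m)) sums (\<integral>\<theta>. exp (- (z * of_real (cos \<theta>))) * w \<theta> \<partial>lborel)"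
  proof (subst sums_mono_reindex)
    show "(- z) ^ n / fact n * c n = 0" if "n \<notin> range ((*) 2)" for n
    proof -
      from that have "odd n" by (auto elim!: evenE)
      then show ?thesis using odd by (auto elim!: oddE)
    qed
  qed (auto simp: strict_mono_def)
  also have "(\<lambda>m. (- z) ^ (2 * m) / fact (2 * m) * c (2 * m)) =
      (\<lambda>m. (of_real (sqrt pi) * Gamma ((\<mu> + 1) / 2)) *
        (rGamma (of_nat m + \<mu> / 2 + 1) * (z / 2) ^ (2 * m) / of_nat (fact m)))"
  proof
    fix m
    have "(- z) ^ (2 * m) = z ^ (2 * m)" "(2 :: complex) ^ (2 * m) = 4 ^ m"
      by (simp_all add: power_mult power_divide)
    then show "(- z) ^ (2 * m) / fact (2 * m) * c (2 * m) = (of_real (sqrt pi) * Gamma ((\<mu> + 1) / 2)) *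
        (rGamma (of_nat m + \<mu> / 2 + 1) * (z / 2) ^ (2 * m) / of_nat (fact m))"
      by (simp add: even power_divide divide_simps)
  qed
  finally have sums: "(\<lambda>m. (of_real (sqrt pi) * Gamma ((\<mu> + 1) / 2)) *
        (rGamma (of_nat m + \<mu> / 2 + 1) * (z / 2) ^ (2 * m) / of_nat (fact m))) sums
        (\<integral>\<theta>. exp (- (z * of_real (cos \<theta>))) * w \<theta> \<partial>lborel)" .
  have G: "Gamma ((\<mu> + 1) / 2) \<noteq> 0"
    using \<mu> by (intro Gamma_nonzero_Re_pos) simp
  \<comment> \<open>\<open>bessel_I_norm\<close> is a bare infinite sum. Its convergence is read off
    from the integrated series by cancelling the nonzero constant.\<close>
  have "summable (\<lambda>m. rGamma (of_nat m + \<mu> / 2 + 1) * (z / 2) ^ (2 * m) / of_nat (fact m))"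
    using sums_summable[OF sums] G unfolding summable_cmult_iff by simp
  then have "(\<integral>\<theta>. exp (- (z * of_real (cos \<theta>))) * w \<theta> \<partial>lborel) =
      of_real (sqrt pi) * Gamma ((\<mu> + 1) / 2) * bessel_I_norm (\<mu> / 2) z"
    unfolding bessel_I_norm_def by (intro sums_unique2[OF sums] sums_mult summable_sums)
  moreover have "(LINT \<theta>:{0..pi}|lborel. exp (- (z * of_real (cos \<theta>))) * complex_of_real (sin \<theta>) powr \<mu>) =
      (\<integral>\<theta>. exp (- (z * of_real (cos \<theta>))) * w \<theta> \<partial>lborel)"
    by (simp add: w_def set_lebesgue_integral_def)
  ultimately show ?thesis
    using G by (simp only:) simp
qed

section \<open>Poisson integral of the Macdonald function\<close>

text \<open>A crude quadratic bound, enough to dominate exp(-c cosh y) by a Gaussian.\<close>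

lemma cosh_real_ge_square: "cosh (y::real) \<ge> y\<^sup>2 / 4"
proof -
  define u where "u = \<bar>y\<bar>"
  have "cosh u \<ge> exp u / 2" by (simp add: cosh_field_def)
  moreover have "u \<ge> 0" by (simp add: u_def)
  moreover from this have "exp u \<ge> 1 + u + u\<^sup>2 / 2" by (rule exp_lower_Taylor_quadratic)
  ultimately have "cosh u \<ge> u\<^sup>2 / 4" by linarith
  moreover have "cosh u = cosh y" by (cases "y \<ge> 0") (simp_all add: u_def)
  ultimately show ?thesis by (simp add: u_def)
qed

lemma integrable_exp_cosh:
  fixes a c :: real
  assumes c: "c > 0"
  shows "integrable lborel (\<lambda>y. exp (a * \<bar>y\<bar> - c * cosh y))"
proof (rule Bochner_Integration.integrable_bound)
  show "integrable lborel (\<lambda>y. exp (2 * a\<^sup>2 / c) * (exp (- (c / 8 * y\<^sup>2)) * y ^ (2 * 0)))"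
    using c by (intro integrable_mult_right integrable.intros[OF has_bochner_integral_gaussian_moment]) auto
  show "AE y in lborel. norm (exp (a * \<bar>y\<bar> - c * cosh y)) \<le>
      norm (exp (2 * a\<^sup>2 / c) * (exp (- (c / 8 * y\<^sup>2)) * y ^ (2 * 0)))"
  proof (intro AE_I2)
    fix y :: real
    \<comment> \<open>Completing the square: half of the quadratic bound c y^2/4 absorbs the linear
      term a|y|, and c y^2/8 remains for the Gaussian.\<close>
    have "0 \<le> (c * \<bar>y\<bar> - 4 * a)\<^sup>2 / (8 * c)" using c by simp
    also have "\<dots> = c / 8 * y\<^sup>2 - a * \<bar>y\<bar> + 2 * a\<^sup>2 / c"
      using c by (simp add: power2_eq_square field_simps)
    finally have "a * \<bar>y\<bar> \<le> c / 8 * y\<^sup>2 + 2 * a\<^sup>2 / c" by simp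
    moreover have "c * (y\<^sup>2 / 4) \<le> c * cosh y"
      using c cosh_real_ge_square[of y] by (intro mult_left_mono) auto
    ultimately have "a * \<bar>y\<bar> - c * cosh y \<le> 2 * a\<^sup>2 / c + - (c / 8 * y\<^sup>2)" by simp
    then have "exp (a * \<bar>y\<bar> - c * cosh y) \<le> exp (2 * a\<^sup>2 / c + - (c / 8 * y\<^sup>2))" by simp
    then show "norm (exp (a * \<bar>y\<bar> - c * cosh y)) \<le>
        norm (exp (2 * a\<^sup>2 / c) * (exp (- (c / 8 * y\<^sup>2)) * y ^ (2 * 0)))"
      unfolding exp_add by simp
  qed
qed simp

lemma integrable_exp_linear_cosh:
  fixes c :: real and a :: complex
  assumes c: "c > 0"
  shows "integrable lborel (\<lambda>y. exp (a * of_real y) * of_real (exp (- (c * cosh y))))"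
proof (rule Bochner_Integration.integrable_bound[OF integrable_exp_cosh[OF c, of "\<bar>Re a\<bar>"]])
  show "AE y in lborel. norm (exp (a * of_real y) * complex_of_real (exp (- (c * cosh y)))) \<le>
      norm (exp (\<bar>Re a\<bar> * \<bar>y\<bar> - c * cosh y))"
  proof (intro AE_I2)
    fix y
    have "Re a * y \<le> \<bar>Re a\<bar> * \<bar>y\<bar>" by (metis abs_ge_self abs_mult)
    then show "norm (exp (a * of_real y) * complex_of_real (exp (- (c * cosh y)))) \<le>
        norm (exp (\<bar>Re a\<bar> * \<bar>y\<bar> - c * cosh y))"
      by (simp add: norm_mult flip: exp_add)
  qed
qed auto

section \<open>Whole-line integrals behind the Macdonald function\<close>

lemma integral_symmetrize:
  fixes f :: "real \<Rightarrow> complex"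
  assumes "integrable lborel f"
  shows "integral\<^sup>L lborel f = (\<integral>y. (f y + f (- y)) / 2 \<partial>lborel)"
proof -
  have "integrable lborel (\<lambda>y. f (0 + (-1) * y))"
    using assms by (rule lborel_integrable_real_affine) simp
  then have i: "integrable lborel (\<lambda>y. f (- y))" by simp
  have "integral\<^sup>L lborel f = (\<integral>y. f (- y) \<partial>lborel)"
    using lborel_integral_real_affine[of "-1" f 0] by simp
  then show ?thesis using assms i by simp
qed

text \<open>This is 2 K_(1/2)(c), one of the elementary cases. Symmetrising replaces exp(y/2) by
  cosh(y/2). With y = 2 arsinh w one has cosh y = 1 + 2w^2 and cosh(y/2) = sqrt(w^2 + 1), which
  cancels against dy = 2 dw / sqrt(w^2 + 1), so a Gaussian integral remains.\<close>

lemma has_bochner_integral_exp_half_cosh: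
  fixes c :: real
  assumes c: "c > 0"
  shows "has_bochner_integral lborel (\<lambda>y. exp (of_real y / 2) * of_real (exp (- (c * cosh y))))
    (complex_of_real (sqrt (2 * pi / c) * exp (- c)))"
proof -
  let ?f = "\<lambda>y::real. complex_of_real (exp (- (c * cosh y)) * cosh (y / 2))"
  let ?g = "\<lambda>y::real. 2 * arsinh y" and ?g' = "\<lambda>y::real. 2 / sqrt (y\<^sup>2 + 1)"
  have pos: "y\<^sup>2 + 1 > 0" for y :: real by (simp add: add_nonneg_pos)
  have eq: "?g' y *\<^sub>R ?f (?g y) = of_real (2 * exp (- c) * (exp (- (2 * c * y\<^sup>2)) * y ^ (2 * 0)))" for y
  proof -
    have "cosh (2 * arsinh y) = 1 + 2 * y\<^sup>2"
      using pos[of y] by (simp add: cosh_double cosh_arsinh_real)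
    moreover have "cosh (2 * arsinh y / 2) = sqrt (y\<^sup>2 + 1)" by (simp add: cosh_arsinh_real)
    moreover have "exp (- (c * (1 + 2 * y\<^sup>2))) = exp (- c) * exp (- (2 * c * y\<^sup>2))"
      by (simp add: algebra_simps flip: exp_add)
    ultimately show ?thesis using pos[of y] by (simp add: scaleR_conv_of_real)
  qed
  have int: "has_bochner_integral lborel (\<lambda>y. ?g' y *\<^sub>R ?f (?g y))
      (of_real (2 * exp (- c) * (sqrt pi * fact (2 * 0) / (4 ^ 0 * fact 0) * (2 * c) powr (- real 0 - 1 / 2))))"
    unfolding eq using c
    by (intro has_bochner_integral_of_real has_bochner_integral_mult_right has_bochner_integral_gaussian_moment) simp
  have UNIV: "einterval (-\<infinity>) \<infinity> = UNIV" by (simp add: einterval_def)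
  have int': "set_integrable lborel (einterval (-\<infinity>) \<infinity>) (\<lambda>y. ?g' y *\<^sub>R ?f (?g y))"
    using integrable.intros[OF int] unfolding set_integrable_def UNIV by simp
  have deriv: "DERIV ?g y :> ?g' y" for y
    by (auto intro!: derivative_eq_intros)
  have cont: "isCont ?f (?g y)" for y by (intro continuous_intros) simp
  have cont': "isCont ?g' y" for y
    using pos[of y] by (intro continuous_intros) auto
  have nonneg: "0 \<le> ?g' y" for y by simp
  have "filterlim ?g at_top at_top"
    by (intro filterlim_tendsto_pos_mult_at_top[OF tendsto_const] arsinh_real_at_top) simp
  then have lim2: "((ereal \<circ> ?g \<circ> real_of_ereal) \<longlongrightarrow> \<infinity>) (at_left \<infinity>)"
    by (simp add: ereal_tendsto_simps)
  have "filterlim ?g at_bot at_bot"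
    by (intro filterlim_tendsto_pos_mult_at_bot[OF tendsto_const] arsinh_real_at_bot) simp
  then have lim1: "((ereal \<circ> ?g \<circ> real_of_ereal) \<longlongrightarrow> -\<infinity>) (at_right (-\<infinity>))"
    by (simp add: ereal_tendsto_simps)
  have meas: "?f \<in> borel_measurable borel" by measurable
  note subst = _ deriv cont cont' nonneg lim1 lim2 meas int'
  have "(LBINT x=-\<infinity>..\<infinity>. ?f x) = (LBINT x=-\<infinity>..\<infinity>. ?g' x *\<^sub>R ?f (?g x))"
    by (rule interval_integral_substitution[OF subst]) simp
  then have "(\<integral>y. ?f y \<partial>lborel) = (\<integral>y. ?g' y *\<^sub>R ?f (?g y) \<partial>lborel)"
    by (simp only: interval_lebesgue_integral_def set_lebesgue_integral_def UNIV indicator_UNIV scaleR_one) simp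
  also have "\<dots> = of_real (2 * exp (- c) * (sqrt pi * (2 * c) powr (- (1 / 2))))"
    using has_bochner_integral_integral_eq[OF int] by simp
  also have "2 * exp (- c) * (sqrt pi * (2 * c) powr (- (1 / 2))) = sqrt (2 * pi / c) * exp (- c)"
    using c real_div_sqrt[of 2]
    by (simp add: powr_minus_divide powr_half_sqrt real_sqrt_divide real_sqrt_mult field_simps)
  finally have A: "(\<integral>y. ?f y \<partial>lborel) = of_real (sqrt (2 * pi / c) * exp (- c))" .
  have B: "integrable lborel (\<lambda>y. exp (of_real y / 2) * complex_of_real (exp (- (c * cosh y))))"
    using integrable_exp_linear_cosh[OF c, of "1 / 2"] by simp
  have "(exp (of_real y / 2) * of_real (exp (- (c * cosh y))) +
      exp (of_real (- y) / 2) * of_real (exp (- (c * cosh (- y))))) / 2 = ?f y" for y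
    by (simp add: cosh_field_def algebra_simps add_divide_distrib flip: exp_of_real)
  with integral_symmetrize[OF B] A B show ?thesis by (simp only: has_bochner_integral_iff)
qed

text \<open>Translation by t = ln(z/(2v)) balances the two exponentials: v^2 e^y and (z^2/4) e^(-y)
  become (zv/2) e^y and (zv/2) e^(-y), with sum zv cosh y. The factor exp(-\<alpha> y) contributes
  the power of z/(2v).\<close>

lemma has_bochner_integral_exp_exp:
  fixes v z :: real and \<alpha> :: complex
  assumes v: "v > 0" and z: "z > 0"
  assumes int: "has_bochner_integral lborel (\<lambda>y. exp (- (\<alpha> * of_real y)) * of_real (exp (- (z * v * cosh y)))) I"
  shows "has_bochner_integral lborel
    (\<lambda>y. exp (- (\<alpha> * of_real y)) * of_real (exp (- (v\<^sup>2 * exp y + z\<^sup>2 / 4 * exp (- y)))))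
    (of_real (z / (2 * v)) powr (- \<alpha>) * I)"
proof -
  define t where "t = ln (z / (2 * v))"
  have t: "exp t = z / (2 * v)" using v z by (simp add: t_def)
  have "v\<^sup>2 * exp (t + y) + z\<^sup>2 / 4 * exp (- (t + y)) = z * v * cosh y" for y
  proof -
    have "v\<^sup>2 * exp (t + y) = z * v / 2 * exp y"
      using v by (simp add: exp_add t power2_eq_square)
    moreover have "exp (- t) = 2 * v / z" using t v z by (simp add: exp_minus)
    then have "z\<^sup>2 / 4 * exp (- (t + y)) = z * v / 2 * exp (- y)"
      using z exp_add[of "- t" "- y"] by (simp add: power2_eq_square)
    ultimately show ?thesis by (simp add: cosh_field_def field_simps)
  qed
  moreover have "exp (- (\<alpha> * of_real (t + y))) = of_real (z / (2 * v)) powr (- \<alpha>) * exp (- (\<alpha> * of_real y))" for y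
  proof -
    have "of_real (z / (2 * v)) powr (- \<alpha>) = exp (- (\<alpha> * of_real t))"
      using v z by (simp add: powr_def t_def Ln_of_real flip: of_real_mult of_real_divide)
    then show ?thesis by (simp add: algebra_simps flip: exp_add)
  qed
  ultimately have eq: "exp (- (\<alpha> * of_real (t + 1 * y))) *
        of_real (exp (- (v\<^sup>2 * exp (t + 1 * y) + z\<^sup>2 / 4 * exp (- (t + 1 * y))))) =
      of_real (z / (2 * v)) powr (- \<alpha>) * (exp (- (\<alpha> * of_real y)) * of_real (exp (- (z * v * cosh y))))" for y
    by (simp only: mult_1_left mult.assoc)
  show ?thesis
    by (subst lborel_has_bochner_integral_real_affine_iff[of 1 _ _ t])
       (simp, unfold eq, use int in \<open>simp add: has_bochner_integral_mult_right\<close>)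
qed

text \<open>
  Up to the factor $v$ this writes $e^{-zv}$ as a mixture of Gaussians in $v$; for
  $v = \cosh\varphi$ the integral over $\varphi$ becomes a Gamma integral.
\<close>
lemma has_bochner_integral_Gaussian_mixture:
  fixes v z :: real
  assumes v: "v > 0" and z: "z > 0"
  shows "has_bochner_integral lborel
    (\<lambda>y. exp (of_real y / 2) * complex_of_real (exp (- (v\<^sup>2 * exp y + z\<^sup>2 / 4 * exp (- y)))))
    (of_real (sqrt pi * exp (- (z * v)) / v))"
proof -
  have "has_bochner_integral lborel
    (\<lambda>y. exp (- (- (1 / 2) * of_real y)) * complex_of_real (exp (- (v\<^sup>2 * exp y + z\<^sup>2 / 4 * exp (- y)))))
    (of_real (z / (2 * v)) powr (- (- (1 / 2))) * of_real (sqrt (2 * pi / (z * v)) * exp (- (z * v))))"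
    using has_bochner_integral_exp_half_cosh[of "z * v"] v z
    by (intro has_bochner_integral_exp_exp) auto
  moreover have "complex_of_real (z / (2 * v)) powr (- (- (1 / 2))) = of_real (sqrt (z / (2 * v)))"
    using v z powr_of_real[of "z / (2 * v)" "1 / 2"] by (simp add: powr_half_sqrt)
  moreover have "sqrt (z / (2 * v)) * (sqrt (2 * pi / (z * v)) * exp (- (z * v))) = sqrt pi * exp (- (z * v)) / v"
  proof -
    have "sqrt (z / (2 * v)) * sqrt (2 * pi / (z * v)) = sqrt (z / (2 * v) * (2 * pi / (z * v)))"
      by (rule real_sqrt_mult[symmetric])
    also have "z / (2 * v) * (2 * pi / (z * v)) = pi / v\<^sup>2"
      using v z by (simp add: power2_eq_square)
    also have "sqrt (pi / v\<^sup>2) = sqrt pi / v" using v by (simp add: real_sqrt_divide)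
    finally show ?thesis by (simp add: mult.assoc[symmetric])
  qed
  ultimately show ?thesis by (simp flip: of_real_mult)
qed

text \<open>The defining half-line integral of an even function is half of the whole-line one, where
  the hyperbolic cosine may be replaced by a single exponential. Only the whole-line form can be
  translated.\<close>

lemma bessel_K_of_real:
  assumes z: "z > 0"
  shows "has_bochner_integral lborel (\<lambda>y. exp (- (\<alpha> * of_real y)) * of_real (exp (- (z * cosh y))))
    (2 * bessel_K \<alpha> (of_real z))"
proof -
  let ?f = "\<lambda>y. exp (- (\<alpha> * of_real y)) * complex_of_real (exp (- (z * cosh y)))"
  let ?h = "\<lambda>s. exp (- of_real z * cosh (of_real s)) * cosh (\<alpha> * complex_of_real s)"
  have i: "integrable lborel ?f"
    using integrable_exp_linear_cosh[OF z, of "- \<alpha>"] by simp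
  have i': "integrable lborel (\<lambda>y. exp (\<alpha> * of_real y) * complex_of_real (exp (- (z * cosh y))))"
    using integrable_exp_linear_cosh[OF z, of "\<alpha>"] by simp
  have h: "?h y = (?f y + ?f (- y)) / 2" for y
  proof -
    have "exp (- of_real z * cosh (complex_of_real y)) = of_real (exp (- (z * cosh y)))"
      by (simp add: cosh_field_def flip: exp_of_real)
    then show ?thesis by (simp add: cosh_field_def algebra_simps add_divide_distrib)
  qed
  have hi: "integrable lborel ?h"
    unfolding h using i i' by simp
  have "set_integrable lborel {0..} ?h"
    unfolding set_integrable_def using hi by (intro integrable_mult_indicator) auto
  then have "has_bochner_integral lborel (\<lambda>s. indicator {0..} s *\<^sub>R ?h s) (bessel_K \<alpha> (of_real z))"
    using set_borel_integral_eq_integral(2)[of "{0..}" ?h]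
    by (simp add: has_bochner_integral_iff set_integrable_def set_lebesgue_integral_def bessel_K_def)
  then have "has_bochner_integral lborel ?h (2 *\<^sub>R bessel_K \<alpha> (of_real z))"
    by (rule has_bochner_integral_even_function) simp
  then have "integral\<^sup>L lborel ?h = 2 * bessel_K \<alpha> (of_real z)"
    by (simp add: has_bochner_integral_iff scaleR_conv_of_real)
  with i integral_symmetrize[OF i] show ?thesis by (simp only: has_bochner_integral_iff h)
qed

text \<open>The case v = 1 of the translation: it produces exactly the power (z/2)^(-\<alpha>) of
  the normalisation.\<close>

lemma bessel_K_norm_of_real:
  assumes z: "z > 0"
  shows "has_bochner_integral lborel
    (\<lambda>y. exp (- (\<alpha> * of_real y)) * complex_of_real (exp (- (exp y + z\<^sup>2 / 4 * exp (- y)))))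
    (2 * bessel_K_norm \<alpha> (of_real z))"
proof -
  have "has_bochner_integral lborel
      (\<lambda>y. exp (- (\<alpha> * of_real y)) * complex_of_real (exp (- (1\<^sup>2 * exp y + z\<^sup>2 / 4 * exp (- y)))))
      (of_real (z / (2 * 1)) powr (- \<alpha>) * (2 * bessel_K \<alpha> (of_real z)))"
    using bessel_K_of_real[OF z, of \<alpha>] z by (intro has_bochner_integral_exp_exp) simp_all
  then show ?thesis by (simp add: bessel_K_norm_def mult_ac)
qed

text \<open>With w = sinh^2 \<phi>, the factor cosh \<phi> is absorbed by the differential and a
  Gamma integral in w remains.\<close>

lemma has_bochner_integral_cosh_sinh_powr:
  assumes \<nu>: "Re \<nu> > -1" and s: "s > 0"
  shows "has_bochner_integral lborel
    (\<lambda>\<phi>. indicator {0<..} \<phi> *\<^sub>R (of_real (cosh \<phi> * exp (- (s * (sinh \<phi>)\<^sup>2))) * complex_of_real (sinh \<phi>) powr \<nu>))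
    (1 / 2 * (Gamma ((\<nu> + 1) / 2) * of_real s powr (- ((\<nu> + 1) / 2))))"
proof -
  let ?f = "\<lambda>\<phi>. of_real (cosh \<phi> * exp (- (s * (sinh \<phi>)\<^sup>2))) * complex_of_real (sinh \<phi>) powr \<nu>"
  let ?g = "\<lambda>w. arsinh (sqrt w)" and ?g' = "\<lambda>w. 1 / sqrt (w + 1) * (1 / (2 * sqrt w))"
  have eq: "?g' w *\<^sub>R ?f (?g w) =
      1 / 2 * (complex_of_real w powr ((\<nu> + 1) / 2 - 1) * of_real (exp (- (s * w))))" if w: "w > 0" for w
  proof -
    have "complex_of_real (sqrt w) powr \<nu> = of_real w powr (\<nu> / 2)"
      using of_real_powr_powr[OF w, of "1 / 2" \<nu>] w by (simp add: powr_half_sqrt)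
    moreover have "complex_of_real (1 / sqrt w) = of_real w powr (- (1 / 2))"
      using w powr_of_real[of w "- (1 / 2)"] by (simp add: powr_minus_divide powr_half_sqrt)
    moreover have "complex_of_real w powr ((\<nu> + 1) / 2 - 1) = of_real w powr (\<nu> / 2) * of_real w powr (- (1 / 2))"
      by (simp add: add_divide_distrib flip: powr_add)
    moreover have "?g' w *\<^sub>R ?f (?g w) =
        1 / 2 * (complex_of_real (sqrt w) powr \<nu> * complex_of_real (1 / sqrt w) * of_real (exp (- (s * w))))"
      using w by (simp add: cosh_arsinh_real scaleR_conv_of_real)
    ultimately show ?thesis by (simp only:)
  qed
  have ein: "einterval 0 \<infinity> = {0<..}" by (auto simp: einterval_def)
  have int: "has_bochner_integral lborel (\<lambda>w. indicator {0<..} w *\<^sub>R (?g' w *\<^sub>R ?f (?g w)))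
      (1 / 2 * (Gamma ((\<nu> + 1) / 2) * of_real s powr (- ((\<nu> + 1) / 2))))"
  proof -
    have "has_bochner_integral lborel (\<lambda>w. 1 / 2 * (indicator {0<..} w *\<^sub>R
        (complex_of_real w powr ((\<nu> + 1) / 2 - 1) * of_real (exp (- (s * w))))))
        (1 / 2 * (Gamma ((\<nu> + 1) / 2) * of_real s powr (- ((\<nu> + 1) / 2))))"
      using \<nu> s by (intro has_bochner_integral_mult_right has_bochner_integral_Gamma) simp_all
    moreover have "indicator {0<..} w *\<^sub>R (?g' w *\<^sub>R ?f (?g w)) = 1 / 2 * (indicator {0<..} w *\<^sub>R
        (complex_of_real w powr ((\<nu> + 1) / 2 - 1) * of_real (exp (- (s * w)))))" for w
    proof (cases "w > 0")
      case True
      then show ?thesis unfolding eq[OF True] by simp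
    qed simp
    ultimately show ?thesis by (simp only:)
  qed
  have int': "set_integrable lborel (einterval 0 \<infinity>) (\<lambda>w. ?g' w *\<^sub>R ?f (?g w))"
    using integrable.intros[OF int] unfolding set_integrable_def ein .
  have deriv: "DERIV ?g w :> ?g' w" if "0 < ereal w" for w
  proof -
    have w: "w > 0" using that by simp
    have "(sqrt has_real_derivative 1 / (2 * sqrt w)) (at w)"
      using DERIV_real_sqrt[OF w] by (simp add: field_simps)
    from DERIV_chain2[OF arsinh_real_has_field_derivative this] show ?thesis using w by simp
  qed
  have cont: "isCont ?f (?g w)" if "0 < ereal w" for w
    using that by (intro continuous_intros) (auto simp: complex_nonpos_Reals_iff)
  have cont': "isCont ?g' w" if "0 < ereal w" for w
    using that by (intro continuous_intros) auto
  have nonneg: "0 \<le> ?g' w" if "0 \<le> ereal w" for w using that by simp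
  have "filterlim ?g at_top at_top"
    by (rule filterlim_compose[OF arsinh_real_at_top sqrt_at_top])
  then have lim2: "((ereal \<circ> ?g \<circ> real_of_ereal) \<longlongrightarrow> \<infinity>) (at_left \<infinity>)"
    by (simp add: ereal_tendsto_simps)
  have "isCont ?g 0" by (intro continuous_intros)
  then have "(?g \<longlongrightarrow> 0) (at_right 0)"
    by (simp add: isCont_def filterlim_at_split)
  then have lim1: "((ereal \<circ> ?g \<circ> real_of_ereal) \<longlongrightarrow> 0) (at_right 0)"
    unfolding zero_ereal_def ereal_tendsto_simps .
  have meas: "?f \<in> borel_measurable borel" by measurable
  note subst = _ deriv cont cont' nonneg lim1 lim2 meas int'
  have "set_integrable lborel (einterval 0 \<infinity>) ?f"
    by (rule set_integrable_substitution[OF subst]) simp_all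
  moreover have "(LBINT \<phi>=0..\<infinity>. ?f \<phi>) = (LBINT w=0..\<infinity>. ?g' w *\<^sub>R ?f (?g w))"
    by (rule interval_integral_substitution[OF subst]) simp_all
  then have "(\<integral>\<phi>. indicator {0<..} \<phi> *\<^sub>R ?f \<phi> \<partial>lborel) =
      (\<integral>w. indicator {0<..} w *\<^sub>R (?g' w *\<^sub>R ?f (?g w)) \<partial>lborel)"
    by (simp only: interval_lebesgue_integral_def set_lebesgue_integral_def ein) simp
  ultimately show ?thesis
    unfolding has_bochner_integral_iff has_bochner_integral_integral_eq[OF int] set_integrable_def ein by blast
qed

text \<open>A double integral is evaluated in two orders. Over y, the Gaussian mixture with v = cosh
  \<phi> gives the Poisson integrand. Over \<phi>, cosh^2 = 1 + sinh^2 separates a Gamma integral at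
  s = e^y, whose value e^(-(\<nu> + 1) y/2) combines with e^(y/2) to the integrand of
  \<open>bessel_K_norm_of_real\<close> at order \<nu>/2.\<close>

lemma bessel_K_norm_Poisson_of_real:
  fixes z :: real
  assumes \<nu>: "Re \<nu> > -1" and z: "z > 0"
  shows "has_bochner_integral lborel
    (\<lambda>\<phi>. indicator {0<..} \<phi> *\<^sub>R (of_real (exp (- (z * cosh \<phi>))) * complex_of_real (sinh \<phi>) powr \<nu>))
    (Gamma ((\<nu> + 1) / 2) / of_real (sqrt pi) * bessel_K_norm (\<nu> / 2) (of_real z))"
proof -
  define W where "W = (\<lambda>\<nu> \<phi>. indicator {0<..} \<phi> *\<^sub>R (complex_of_real (sinh \<phi>) powr \<nu>))"
  define E where "E = (\<lambda>y \<phi>. exp (of_real y / 2) * complex_of_real (exp (- ((cosh \<phi>)\<^sup>2 * exp y + z\<^sup>2 / 4 * exp (- y)))))"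
  \<comment> \<open>The factor cosh \<phi> cancels the 1/v of the mixture and supplies the
    differential of sinh \<phi> in the other order.\<close>
  define F where "F = (\<lambda>\<nu> y \<phi>. E y \<phi> * of_real (cosh \<phi>) * W \<nu> \<phi>)"
  have [measurable]: "case_prod (F \<nu>) \<in> borel_measurable (lborel \<Otimes>\<^sub>M lborel)"
    unfolding F_def E_def W_def by measurable
  have in_phi: "has_bochner_integral lborel (\<lambda>\<phi>. F \<nu> y \<phi>)
      (1 / 2 * Gamma ((\<nu> + 1) / 2) * (exp (- (\<nu> / 2 * of_real y)) *
        of_real (exp (- (exp y + z\<^sup>2 / 4 * exp (- y))))))" if "Re \<nu> > -1" for y \<nu>
  proof -
    let ?c = "exp (of_real y / 2) * complex_of_real (exp (- (exp y + z\<^sup>2 / 4 * exp (- y))))"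
    have "has_bochner_integral lborel (\<lambda>\<phi>. ?c *
        (indicator {0<..} \<phi> *\<^sub>R (of_real (cosh \<phi> * exp (- (exp y * (sinh \<phi>)\<^sup>2))) * complex_of_real (sinh \<phi>) powr \<nu>)))
        (?c * (1 / 2 * (Gamma ((\<nu> + 1) / 2) * of_real (exp y) powr (- ((\<nu> + 1) / 2)))))"
      using that by (intro has_bochner_integral_mult_right has_bochner_integral_cosh_sinh_powr) simp_all
    moreover have "?c * (indicator {0<..} \<phi> *\<^sub>R (of_real (cosh \<phi> * exp (- (exp y * (sinh \<phi>)\<^sup>2))) *
        complex_of_real (sinh \<phi>) powr \<nu>)) = F \<nu> y \<phi>" for \<phi>
    proof -
      have "exp (- ((cosh \<phi>)\<^sup>2 * exp y + z\<^sup>2 / 4 * exp (- y))) =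
          exp (- (exp y + z\<^sup>2 / 4 * exp (- y))) * exp (- (exp y * (sinh \<phi>)\<^sup>2))"
        by (simp add: cosh_square_eq algebra_simps flip: exp_add)
      then show ?thesis
        by (simp add: F_def E_def W_def scaleR_conv_of_real mult_ac)
    qed
    moreover have "?c * (1 / 2 * (Gamma ((\<nu> + 1) / 2) * of_real (exp y) powr (- ((\<nu> + 1) / 2)))) =
        1 / 2 * Gamma ((\<nu> + 1) / 2) * (exp (- (\<nu> / 2 * of_real y)) *
        of_real (exp (- (exp y + z\<^sup>2 / 4 * exp (- y)))))"
    proof -
      have "complex_of_real (exp y) powr (- ((\<nu> + 1) / 2)) = exp (- ((\<nu> + 1) / 2) * of_real y)"
        by (simp add: powr_def Ln_of_real mult_ac)
      then have "exp (of_real y / 2) * complex_of_real (exp y) powr (- ((\<nu> + 1) / 2)) =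
          exp (- (\<nu> / 2 * of_real y))"
        by (simp add: algebra_simps add_divide_distrib flip: exp_add)
      then show ?thesis by (simp add: mult_ac)
    qed
    ultimately show ?thesis by (simp only:)
  qed
  have in_y: "has_bochner_integral lborel (\<lambda>y. F \<nu> y \<phi>)
      (of_real (sqrt pi) * (indicator {0<..} \<phi> *\<^sub>R (of_real (exp (- (z * cosh \<phi>))) * complex_of_real (sinh \<phi>) powr \<nu>)))" for \<phi>
  proof -
    have "has_bochner_integral lborel (\<lambda>y. E y \<phi> * (of_real (cosh \<phi>) * W \<nu> \<phi>))
       (of_real (sqrt pi * exp (- (z * cosh \<phi>)) / cosh \<phi>) * (of_real (cosh \<phi>) * W \<nu> \<phi>))"
      unfolding E_def using z cosh_real_pos[of \<phi>]
      by (intro has_bochner_integral_mult_left has_bochner_integral_Gaussian_mixture)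
    then show ?thesis by (simp add: F_def W_def mult.assoc)
  qed
  \<comment> \<open>The modulus of \<open>F\<close> is \<open>F\<close> itself at the real exponent
    \<open>Re \<nu>\<close>, so absolute integrability follows from the same inner evaluation; hence
    \<open>F\<close> keeps \<nu> as an argument.\<close>
  have F_real: "F (of_real (Re \<nu>)) y \<phi> = of_real (norm (F \<nu> y \<phi>))" for y \<phi>
    by (auto simp: F_def W_def E_def norm_mult indicator_def norm_powr_real_powr powr_Reals_eq
        simp flip: exp_of_real)
  have prod: "integrable (lborel \<Otimes>\<^sub>M lborel) (case_prod (F \<nu>))"
  proof (rule lborel_pair.Fubini_integrable)
    have "has_bochner_integral lborel (\<lambda>\<phi>. norm (F \<nu> y \<phi>))
      (Re (1 / 2 * Gamma ((of_real (Re \<nu>) + 1) / 2) * (exp (- (of_real (Re \<nu>) / 2 * of_real y)) *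
        of_real (exp (- (exp y + z\<^sup>2 / 4 * exp (- y)))))))" for y
      using has_bochner_integral_Re[OF in_phi[of "of_real (Re \<nu>)" y]] \<nu> by (simp only: F_real Re_complex_of_real)
    then have "(\<integral>\<phi>. norm (F \<nu> y \<phi>) \<partial>lborel) =
        Re (1 / 2 * Gamma ((of_real (Re \<nu>) + 1) / 2) * (exp (- (of_real (Re \<nu>) / 2 * of_real y)) *
        of_real (exp (- (exp y + z\<^sup>2 / 4 * exp (- y))))))" for y
      by (rule has_bochner_integral_integral_eq)
    moreover have "integrable lborel (\<lambda>y. Re (1 / 2 * Gamma ((of_real (Re \<nu>) + 1) / 2) * (exp (- (of_real (Re \<nu>) / 2 * of_real y)) *
        of_real (exp (- (exp y + z\<^sup>2 / 4 * exp (- y)))))))"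
      by (intro integrable_Re integrable_mult_right integrable.intros[OF bessel_K_norm_of_real[OF z]])
    ultimately show "integrable lborel (\<lambda>y. \<integral>\<phi>. norm (case (y, \<phi>) of (y, \<phi>) \<Rightarrow> F \<nu> y \<phi>) \<partial>lborel)"
      by (simp only: prod.case)
    show "AE y in lborel. integrable lborel (\<lambda>\<phi>. case (y, \<phi>) of (y, \<phi>) \<Rightarrow> F \<nu> y \<phi>)"
      using integrable.intros[OF in_phi[OF \<nu>]] by simp
  qed simp
  define h where "h = (\<lambda>\<phi>. indicator {0<..} \<phi> *\<^sub>R (of_real (exp (- (z * cosh \<phi>))) * complex_of_real (sinh \<phi>) powr \<nu>))"
  have eq: "(\<integral>y. F \<nu> y \<phi> \<partial>lborel) = of_real (sqrt pi) * h \<phi>" for \<phi>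
    using has_bochner_integral_integral_eq[OF in_y] by (simp add: h_def)
  have "integrable lborel (\<lambda>\<phi>. \<integral>y. F \<nu> y \<phi> \<partial>lborel)"
    by (rule lborel_pair.integrable_snd[OF prod])
  then have int: "integrable lborel h"
    unfolding eq by (rule integrable_cmult_cancel) simp
  have "of_real (sqrt pi) * integral\<^sup>L lborel h = (\<integral>\<phi>. (\<integral>y. F \<nu> y \<phi> \<partial>lborel) \<partial>lborel)"
    unfolding eq using int by simp
  also have "\<dots> = (\<integral>y. (\<integral>\<phi>. F \<nu> y \<phi> \<partial>lborel) \<partial>lborel)"
    by (rule lborel_pair.Fubini_integral[OF prod])
  also have "\<dots> = 1 / 2 * Gamma ((\<nu> + 1) / 2) * (2 * bessel_K_norm (\<nu> / 2) (of_real z))"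
    unfolding has_bochner_integral_integral_eq[OF in_phi[OF \<nu>]]
    by (intro has_bochner_integral_integral_eq has_bochner_integral_mult_right bessel_K_norm_of_real[OF z])
  finally have "integral\<^sup>L lborel h = Gamma ((\<nu> + 1) / 2) / of_real (sqrt pi) * bessel_K_norm (\<nu> / 2) (of_real z)"
    by (simp add: field_simps)
  with int show ?thesis by (simp add: has_bochner_integral_iff h_def)
qed

text \<open>At v = 1 the Gaussian mixture is literally the integral representing the order -1/2, so
  comparing the two values suffices.\<close>

lemma bessel_K_norm_neg_half_of_real:
  assumes z: "z > 0"
  shows "bessel_K_norm (- 1 / 2) (complex_of_real z) = of_real (sqrt pi / 2 * exp (- z))"
proof -
  have "2 * bessel_K_norm (- 1 / 2) (complex_of_real z) = of_real (sqrt pi * exp (- (z * 1)) / 1)"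
    using has_bochner_integral_integral_eq[OF has_bochner_integral_Gaussian_mixture[of 1 z]]
      has_bochner_integral_integral_eq[OF bessel_K_norm_of_real[OF z, of "- 1 / 2"]] z by simp
  then show ?thesis by (simp add: mult.commute)
qed

section \<open>Power series of integral transforms with Laguerre kernel\<close>

text \<open>On this disc |1 - t| is at least 2/3, hence |t/(1-t)| is at most 1/2, the exponent
  allowed for in the weights.\<close>

lemma norm_laguerre_exponential_le:
  assumes "norm t < 1 / 3"
  shows "norm (exp (- (t * complex_of_real y / (1 - t)))) \<le> exp (\<bar>y\<bar> / 2)"
proof -
  have "norm (1 - t) \<ge> 2 / 3"
    using assms norm_triangle_ineq2[of 1 t] by simp
  then have "norm (t * complex_of_real y / (1 - t)) \<le> (1 / 3 * \<bar>y\<bar>) / (2 / 3)"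
    unfolding norm_divide norm_mult norm_of_real using assms
    by (intro frac_le mult_right_mono) auto
  moreover have "Re (- (t * complex_of_real y / (1 - t))) \<le> norm (t * complex_of_real y / (1 - t))"
    using complex_Re_le_cmod[of "- (t * complex_of_real y / (1 - t))"] by simp
  ultimately show ?thesis by (simp only: norm_exp_eq_Re exp_le_cancel_iff) simp
qed

text \<open>Convergence theorems act on the Lebesgue integral, while the target formulas use
  \<open>integral\<close>; this is the bridge between the two on a set.\<close>

lemma
  fixes u :: "real \<Rightarrow> real" and w :: "real \<Rightarrow> complex"
  assumes [measurable]: "S \<in> sets borel" "u \<in> borel_measurable borel" "w \<in> borel_measurable borel"
    and int: "set_integrable lborel S (\<lambda>p. exp (\<bar>u p\<bar> / 2) * norm (w p))"
  shows laguerre_integrable_on: "(\<lambda>p. laguerre j \<alpha> (u p) * w p) integrable_on S"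
    and set_integrable_laguerre_exponential:
      "norm t < 1 / 3 \<Longrightarrow> set_integrable lborel S (\<lambda>p. exp (- (t * of_real (u p) / (1 - t))) * w p)"
    and has_fps_expansion_laguerre_set_transform:
      "(\<lambda>t. (1 - t) powr (- \<alpha> - 1) * (LINT p:S|lborel. exp (- (t * of_real (u p) / (1 - t))) * w p))
         has_fps_expansion Abs_fps (\<lambda>j. integral S (\<lambda>p. laguerre j \<alpha> (u p) * w p))"
proof -
  define W where "W = (\<lambda>p. indicator S p *\<^sub>R w p)"
  have [measurable]: "W \<in> borel_measurable borel" unfolding W_def by measurable
  have ind: "indicator S p *\<^sub>R (c * w p) = c * W p" for c p by (simp add: W_def)
  have W: "integrable lborel (\<lambda>p. exp (\<bar>u p\<bar> / 2) * norm (W p))"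
    using int by (simp add: set_integrable_def W_def mult.left_commute)
  have lag: "set_integrable lborel S (\<lambda>p. laguerre j \<alpha> (u p) * w p)" for j
    unfolding set_integrable_def ind by (rule integrable_laguerre[OF _ _ W]) auto
  then show "(\<lambda>p. laguerre j \<alpha> (u p) * w p) integrable_on S"
    by (rule set_borel_integral_eq_integral)
  show "set_integrable lborel S (\<lambda>p. exp (- (t * of_real (u p) / (1 - t))) * w p)" if "norm t < 1 / 3"
    unfolding set_integrable_def ind
  proof (rule Bochner_Integration.integrable_bound[OF W])
    show "AE p in lborel. norm (exp (- (t * of_real (u p) / (1 - t))) * W p) \<le>
        norm (exp (\<bar>u p\<bar> / 2) * norm (W p))"
      using norm_laguerre_exponential_le[OF that] by (intro AE_I2) (simp add: norm_mult mult_right_mono)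
  qed simp
  have "integral S (\<lambda>p. laguerre j \<alpha> (u p) * w p) = (\<integral>p. laguerre j \<alpha> (u p) * W p \<partial>lborel)" for j
    using set_borel_integral_eq_integral(2)[OF lag, of j] by (simp only: set_lebesgue_integral_def ind)
  then show "(\<lambda>t. (1 - t) powr (- \<alpha> - 1) * (LINT p:S|lborel. exp (- (t * of_real (u p) / (1 - t))) * w p))
         has_fps_expansion Abs_fps (\<lambda>j. integral S (\<lambda>p. laguerre j \<alpha> (u p) * w p))"
    using has_fps_expansion_laguerre_transform[of u lborel W \<alpha>] W
    by (simp add: set_lebesgue_integral_def ind)
qed

text \<open>The counterpart of \<open>integral_laguerre_product\<close> in which the second weight
  is a point mass at y; it serves the order -1/2.\<close>

lemma integral_laguerre_shift:
  assumes "\<And>i. (\<lambda>p. laguerre i \<alpha> (u p) * w p) integrable_on S"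
  shows "integral S (\<lambda>p. laguerre j (\<alpha> + \<beta> + 1) (u p + y) * w p) =
    (\<Sum>i=0..j. integral S (\<lambda>p. laguerre i \<alpha> (u p) * w p) * laguerre (j - i) \<beta> y)"
proof -
  have "integral S (\<lambda>p. laguerre j (\<alpha> + \<beta> + 1) (u p + y) * w p) =
      integral S (\<lambda>p. \<Sum>i=0..j. (laguerre i \<alpha> (u p) * w p) * laguerre (j - i) \<beta> y)"
    unfolding laguerre_add sum_distrib_right by (simp only: mult_ac)
  also have "\<dots> = (\<Sum>i=0..j. integral S (\<lambda>p. (laguerre i \<alpha> (u p) * w p) * laguerre (j - i) \<beta> y))"
    by (intro Henstock_Kurzweil_Integration.integral_sum integrable_on_mult_left assms) simp
  finally show ?thesis by simp
qed

text \<open>Each term of the addition formula separates the two variables, so the iterated integral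
  splits by linearity alone, without a theorem on product measures.\<close>

lemma integral_laguerre_product:
  assumes 1: "\<And>i. (\<lambda>p. laguerre i \<alpha> (u p) * w p) integrable_on S"
    and 2: "\<And>i. (\<lambda>q. laguerre i \<beta> (u' q) * w' q) integrable_on S'"
  shows "integral S (\<lambda>p. integral S' (\<lambda>q. laguerre j (\<alpha> + \<beta> + 1) (u p + u' q) * w p * w' q)) =
    (\<Sum>i=0..j. integral S (\<lambda>p. laguerre i \<alpha> (u p) * w p) * integral S' (\<lambda>q. laguerre (j - i) \<beta> (u' q) * w' q))"
proof -
  have "integral S' (\<lambda>q. laguerre j (\<alpha> + \<beta> + 1) (u p + u' q) * w p * w' q) =
      (\<Sum>i=0..j. (laguerre i \<alpha> (u p) * w p) * integral S' (\<lambda>q. laguerre (j - i) \<beta> (u' q) * w' q))" for p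
  proof -
    have "integral S' (\<lambda>q. laguerre j (\<alpha> + \<beta> + 1) (u p + u' q) * w p * w' q) =
        integral S' (\<lambda>q. \<Sum>i=0..j. (laguerre i \<alpha> (u p) * w p) * (laguerre (j - i) \<beta> (u' q) * w' q))"
      unfolding laguerre_add sum_distrib_right by (simp only: mult_ac)
    also have "\<dots> = (\<Sum>i=0..j. integral S' (\<lambda>q. (laguerre i \<alpha> (u p) * w p) * (laguerre (j - i) \<beta> (u' q) * w' q)))"
      by (intro Henstock_Kurzweil_Integration.integral_sum integrable_on_mult_right 2) simp
    finally show ?thesis by simp
  qed
  then have "integral S (\<lambda>p. integral S' (\<lambda>q. laguerre j (\<alpha> + \<beta> + 1) (u p + u' q) * w p * w' q)) =
      integral S (\<lambda>p. \<Sum>i=0..j. (laguerre i \<alpha> (u p) * w p) * integral S' (\<lambda>q. laguerre (j - i) \<beta> (u' q) * w' q))"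
    by (simp only:)
  also have "\<dots> = (\<Sum>i=0..j. integral S (\<lambda>p. (laguerre i \<alpha> (u p) * w p) * integral S' (\<lambda>q. laguerre (j - i) \<beta> (u' q) * w' q)))"
    by (intro Henstock_Kurzweil_Integration.integral_sum integrable_on_mult_left 1) simp
  finally show ?thesis by simp
qed

section \<open>Taylor coefficients of products and the identity theorem near 0\<close>

lemma taylor_coeff_product:
  fixes f g h :: "complex \<Rightarrow> complex"
  assumes "f has_fps_expansion Abs_fps A" "g has_fps_expansion Abs_fps B" "\<And>t. h t = f t * g t"
  shows "(deriv ^^ j) h 0 / of_nat (fact j) = (\<Sum>i=0..j. A i * B (j - i))"
proof -
  have "h = (\<lambda>t. f t * g t)" using assms(3) by auto
  then have "h has_fps_expansion Abs_fps A * Abs_fps B"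
    using has_fps_expansion_mult[OF assms(1,2)] by simp
  from fps_nth_fps_expansion[OF this, of j] show ?thesis
    by (simp add: fps_mult_nth)
qed

lemma has_fps_expansion_transfer:
  assumes "f has_fps_expansion F" "eventually (\<lambda>t. f t = g t) (nhds 0)"
  shows "g has_fps_expansion F"
  using has_fps_expansion_cong[OF assms(2) refl] assms(1) by blast

text \<open>Both functions are holomorphic near 0 and agree on positive reals accumulating there, so
  their difference vanishes on a disc.\<close>

lemma has_fps_expansion_eventually_eq:
  fixes f g :: "complex \<Rightarrow> complex"
  assumes f: "f has_fps_expansion F" and g: "g has_fps_expansion G" and r: "r > 0"
    and eq: "\<And>t::real. 0 < t \<Longrightarrow> t < r \<Longrightarrow> f (of_real t) = g (of_real t)"
  shows "eventually (\<lambda>t. f t = g t) (nhds 0)"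
proof -
  obtain s where s: "open s" "0 \<in> s" "f holomorphic_on s"
    using has_fps_expansion_imp_holomorphic[OF f] by metis
  obtain s' where s': "open s'" "0 \<in> s'" "g holomorphic_on s'"
    using has_fps_expansion_imp_holomorphic[OF g] by metis
  have "open (s \<inter> s')" "0 \<in> s \<inter> s'" using s s' by auto
  then obtain \<rho> where \<rho>: "\<rho> > 0" "ball 0 \<rho> \<subseteq> s \<inter> s'" by (metis open_contains_ball)
  define \<delta> where "\<delta> = min r \<rho>"
  have \<delta>: "\<delta> > 0" using r \<rho> by (simp add: \<delta>_def)
  let ?U = "complex_of_real ` {0<..<\<delta>}"
  have "f z - g z = 0" if "z \<in> ball 0 \<rho>" for z
  proof (rule analytic_continuation[where S = "ball 0 \<rho>" and U = ?U and \<xi> = 0 and f = "\<lambda>z. f z - g z"])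
    show "(\<lambda>z. f z - g z) holomorphic_on ball 0 \<rho>"
      using s s' \<rho> by (intro holomorphic_intros) (auto elim: holomorphic_on_subset)
    show "?U \<subseteq> ball 0 \<rho>" by (auto simp: \<delta>_def)
    show "0 islimpt ?U"
    proof (rule islimptI)
      fix T :: "complex set" assume "0 \<in> T" "open T"
      then obtain e where e: "e > 0" "ball 0 e \<subseteq> T" by (metis open_contains_ball)
      have "complex_of_real (min e \<delta> / 2) \<in> ?U" using e \<delta> by (intro imageI) auto
      moreover have "complex_of_real (min e \<delta> / 2) \<in> T" using e \<delta> by (intro subsetD[OF e(2)]) auto
      moreover have "complex_of_real (min e \<delta> / 2) \<noteq> 0" using e \<delta> by simp
      ultimately show "\<exists>y\<in>?U. y \<in> T \<and> y \<noteq> 0" by blast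
    qed
    show "f z - g z = 0" if "z \<in> ?U" for z using that eq by (auto simp: \<delta>_def)
  qed (use \<rho> that in auto)
  then show ?thesis
    using eventually_norm_less_nhds_0[OF \<rho>(1)] by (auto elim: eventually_mono)
qed

text \<open>Since t/(1-t) + 1 = 1/(1-t), a weight exp(-u) changes the Laguerre kernel into the
  exponential at the argument of the second Bessel factor.\<close>

lemma exp_split_one_minus:
  fixes t u :: complex
  assumes "t \<noteq> 1"
  shows "exp (- (t * u / (1 - t))) * exp (- u) = exp (- (u / (1 - t)))"
proof -
  have "- (t * u / (1 - t)) + - u = - (u / (1 - t))"
    using assms by (simp add: field_simps)
  then show ?thesis by (simp flip: exp_add)
qed

text \<open>
  Only analyticity in $t$ matters here: it allows identities proved for real arguments of
  $\widetilde K$ to be extended to a complex neighbourhood of $t = 0$.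
\<close>
lemma bessel_K_norm_has_fps_expansion:
  assumes x: "x > 0"
  shows "\<exists>F. (\<lambda>t. bessel_K_norm \<alpha> (of_real x / (1 - t))) has_fps_expansion F"
proof -
  let ?u = "\<lambda>s. x * cosh s"
  let ?w = "\<lambda>s. of_real (exp (- (x * cosh s))) * ((exp (\<alpha> * of_real s) + exp (- (\<alpha> * of_real s))) / 2)"
  \<comment> \<open>Half of the decay exp(-x cosh s) pays for the weight; the other half still
    dominates the growth exp(|Re \<alpha>| |s|) of the hyperbolic cosine.\<close>
  have int: "set_integrable lborel {0..} (\<lambda>s. exp (\<bar>?u s\<bar> / 2) * norm (?w s))"
    unfolding set_integrable_def
  proof (rule integrable_mult_indicator, simp,
      rule Bochner_Integration.integrable_bound[OF integrable_exp_cosh[of "x / 2" "\<bar>Re \<alpha>\<bar>"]])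
    show "AE s in lborel. norm (exp (\<bar>?u s\<bar> / 2) * norm (?w s)) \<le> norm (exp (\<bar>Re \<alpha>\<bar> * \<bar>s\<bar> - x / 2 * cosh s))"
    proof (intro AE_I2)
      fix s
      have "Re \<alpha> * s \<le> \<bar>Re \<alpha>\<bar> * \<bar>s\<bar>" "- (Re \<alpha> * s) \<le> \<bar>Re \<alpha>\<bar> * \<bar>s\<bar>"
        by (metis abs_ge_self abs_mult, metis abs_ge_minus_self abs_mult)
      then have "exp (Re \<alpha> * s) + exp (- (Re \<alpha> * s)) \<le> exp (\<bar>Re \<alpha>\<bar> * \<bar>s\<bar>) + exp (\<bar>Re \<alpha>\<bar> * \<bar>s\<bar>)"
        by (intro add_mono) simp_all
      from divide_right_mono[OF this, of 2]
      have "(exp (Re \<alpha> * s) + exp (- (Re \<alpha> * s))) / 2 \<le> exp (\<bar>Re \<alpha>\<bar> * \<bar>s\<bar>)" by simp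
      moreover have "norm ((exp (\<alpha> * of_real s) + exp (- (\<alpha> * of_real s))) / 2) \<le>
          (exp (Re \<alpha> * s) + exp (- (Re \<alpha> * s))) / 2"
        using norm_triangle_ineq[of "exp (\<alpha> * of_real s)" "exp (- (\<alpha> * of_real s))"]
        by (simp add: norm_divide)
      ultimately have "norm ((exp (\<alpha> * of_real s) + exp (- (\<alpha> * of_real s))) / 2) \<le> exp (\<bar>Re \<alpha>\<bar> * \<bar>s\<bar>)"
        by (rule order_trans[rotated])
      then have "exp (x * cosh s / 2) * (exp (- (x * cosh s)) * norm ((exp (\<alpha> * of_real s) + exp (- (\<alpha> * of_real s))) / 2))
          \<le> exp (x * cosh s / 2) * (exp (- (x * cosh s)) * exp (\<bar>Re \<alpha>\<bar> * \<bar>s\<bar>))"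
        by (intro mult_left_mono) auto
      also have "\<dots> = exp (\<bar>Re \<alpha>\<bar> * \<bar>s\<bar> - x / 2 * cosh s)"
        by (simp add: field_simps flip: exp_add)
      finally show "norm (exp (\<bar>?u s\<bar> / 2) * norm (?w s)) \<le> norm (exp (\<bar>Re \<alpha>\<bar> * \<bar>s\<bar> - x / 2 * cosh s))"
        using x by (simp add: norm_mult abs_mult)
    qed
  qed (use x in auto)
  let ?T = "\<lambda>t. LINT s:{0..}|lborel. exp (- (t * of_real (?u s) / (1 - t))) * ?w s"
  \<comment> \<open>Laguerre order -1 makes the exponent of the prefactor 0, so this is an expansion
    of \<open>?T\<close> itself near 0.\<close>
  have T: "(\<lambda>t. (1 - t) powr (- (- 1) - 1) * ?T t) has_fps_expansion
      Abs_fps (\<lambda>j. integral {0..} (\<lambda>s. laguerre j (- 1) (?u s) * ?w s))"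
    by (rule has_fps_expansion_laguerre_set_transform[OF _ _ _ int]) auto
  have "eventually (\<lambda>t::complex. norm t < 1 / 3) (nhds 0)"
    by (rule eventually_norm_less_nhds_0) simp
  then have ev: "eventually (\<lambda>t. of_real (x / 2) powr (- \<alpha>) * (1 - t) powr \<alpha> * ((1 - t) powr (- (- 1) - 1) * ?T t) =
      bessel_K_norm \<alpha> (of_real x / (1 - t))) (nhds 0)"
  proof eventually_elim
    case (elim t)
    have t: "t \<noteq> 1" using elim by auto
    have "Re (1 - t) > 0" using elim complex_Re_le_cmod[of t] by simp
    then have nr: "1 - t \<notin> \<real>\<^sub>\<le>\<^sub>0" by (auto simp: complex_nonpos_Reals_iff)
    have "bessel_K \<alpha> (of_real x / (1 - t)) = integral {0..} (\<lambda>s. exp (- (t * of_real (?u s) / (1 - t))) * ?w s)"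
      unfolding bessel_K_def
    proof (rule integral_cong)
      fix s :: real
      have "exp (- (t * of_real (?u s) / (1 - t))) * of_real (exp (- (x * cosh s))) =
          exp (- (of_real (?u s) / (1 - t)))"
        using exp_split_one_minus[OF t, of "of_real (?u s)"] by (simp flip: exp_of_real)
      moreover have "complex_of_real (cosh s) = cosh (of_real s)"
        by (simp add: cosh_field_def flip: exp_of_real)
      ultimately show "exp (- (of_real x / (1 - t)) * cosh (of_real s)) * cosh (\<alpha> * of_real s) =
          exp (- (t * of_real (?u s) / (1 - t))) * ?w s"
        by (simp add: cosh_field_def[of "\<alpha> * of_real s"] mult.assoc[symmetric])
    qed
    also have "\<dots> = ?T t"
      by (rule set_borel_integral_eq_integral(2)[symmetric], rule set_integrable_laguerre_exponential[OF _ _ _ int elim]) auto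
    finally have K: "bessel_K \<alpha> (of_real x / (1 - t)) = ?T t" .
    \<comment> \<open>Principal powers are not multiplicative in general. Here one factor is a
      positive real, and \<open>Ln\<close> respects inversion of 1 - t because 1 - t avoids the
      cut.\<close>
    have "(of_real x / (1 - t) / 2) powr (- \<alpha>) = (of_real (x / 2) * inverse (1 - t)) powr (- \<alpha>)"
      by (simp add: field_simps)
    also have "\<dots> = of_real (x / 2) powr (- \<alpha>) * inverse (1 - t) powr (- \<alpha>)"
      using x by (intro powr_times_real_left) auto
    also have "inverse (1 - t) powr (- \<alpha>) = (1 - t) powr \<alpha>"
      using t nr by (simp add: powr_def Ln_inverse)
    finally show ?case
      using t by (simp add: bessel_K_norm_def K)
  qed
  have "(\<lambda>t. of_real (x / 2) powr (- \<alpha>) * (1 - t) powr \<alpha> * ((1 - t) powr (- (- 1) - 1) * ?T t))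
      has_fps_expansion fps_const (of_real (x / 2) powr (- \<alpha>)) * fps_one_minus_powr \<alpha> *
      Abs_fps (\<lambda>j. integral {0..} (\<lambda>s. laguerre j (- 1) (?u s) * ?w s))"
    by (intro has_fps_expansion_mult has_fps_expansion_const has_fps_expansion_one_minus_powr T)
  then show ?thesis using has_fps_expansion_transfer[OF _ ev] by blast
qed

section \<open>Expansion of the Bessel factors\<close>

lemma eventually_neq_1_nhds_0: "eventually (\<lambda>t::complex. t \<noteq> 1) (nhds 0)"
  by (rule eventually_mono[OF eventually_norm_less_nhds_0[of 1]]) auto

lemma bessel_I_norm_neg_half: "bessel_I_norm (- 1 / 2) z = cosh z / of_real (sqrt pi)"
proof -
  have rG: "rGamma (of_nat m + 1 / 2 :: complex) = 4 ^ m * fact m / (of_real (sqrt pi) * fact (2 * m))" for m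
  proof (induction m)
    case 0
    then show ?case by (simp add: rGamma_inverse_Gamma Gamma_one_half_complex inverse_eq_divide)
  next
    case (Suc m)
    have "(of_nat m + 1 / 2) * rGamma (of_nat m + 1 / 2 + 1 :: complex) = rGamma (of_nat m + 1 / 2)"
      by (rule rGamma_plus1)
    then have "rGamma (of_nat (Suc m) + 1 / 2 :: complex) = rGamma (of_nat m + 1 / 2) / (of_nat m + 1 / 2)"
    proof -
      have "Re (of_nat m + 1 / 2 :: complex) > 0" by simp
      then have "(of_nat m + 1 / 2 :: complex) \<noteq> 0" by force
      moreover have "of_nat (Suc m) + 1 / 2 = (of_nat m + 1 / 2 + 1 :: complex)" by simp
      ultimately show ?thesis
        using \<open>(of_nat m + 1 / 2) * rGamma (of_nat m + 1 / 2 + 1 :: complex) = rGamma (of_nat m + 1 / 2)\<close>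
        by (metis nonzero_mult_div_cancel_left)
    qed
    also have "\<dots> = 4 ^ m * fact m / (of_real (sqrt pi) * fact (2 * m)) / (of_nat m + 1 / 2)"
      by (simp only: Suc)
    also have "\<dots> = 4 ^ Suc m * fact (Suc m) / (of_real (sqrt pi) * fact (2 * Suc m))"
    proof -
      have "fact (2 * Suc m) = (4 * (of_nat m + 1 / 2) * (of_nat m + 1) * fact (2 * m) :: complex)"
        by (simp add: algebra_simps)
      moreover have "fact (Suc m) = ((of_nat m + 1) * fact m :: complex)" by (simp add: algebra_simps)
      moreover have "(of_nat m + 1 :: complex) \<noteq> 0" by (metis of_nat_Suc of_nat_neq_0 add.commute)
      \<comment> \<open>Instantiated with p = m + 1/2 and q = m + 1; abstract variables keep the
        factorials from being unfolded while q is cancelled.\<close>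
      moreover have "a * f / (r * g) / p = 4 * a * (q * f) / (r * (4 * p * q * g))"
        if "q \<noteq> 0" for a f r g p q :: complex
        using that by simp
      ultimately show ?thesis by (simp only: power_Suc)
    qed
    finally show ?case .
  qed
  have "(\<lambda>n. if even n then z ^ n /\<^sub>R fact n else 0) sums cosh z"
    by (rule cosh_converges)
  then have "(\<lambda>m. if even (2 * m) then z ^ (2 * m) /\<^sub>R fact (2 * m) else 0) sums cosh z"
    by (subst sums_mono_reindex) (auto simp: strict_mono_def elim!: evenE)
  then have "(\<lambda>m. z ^ (2 * m) /\<^sub>R fact (2 * m) / of_real (sqrt pi)) sums (cosh z / of_real (sqrt pi))"
    by (intro sums_divide) simp
  moreover have "z ^ (2 * m) /\<^sub>R fact (2 * m) / of_real (sqrt pi) =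
      rGamma (of_nat m + (- 1 / 2) + 1) * (z / 2) ^ (2 * m) / of_nat (fact m)" for m
  proof -
    have "of_nat m + (- 1 / 2) + 1 = (of_nat m + 1 / 2 :: complex)" by simp
    moreover have "(2 :: complex) ^ (2 * m) = 4 ^ m" by (simp add: power_mult)
    ultimately show ?thesis
      by (simp only: rG power_divide) (simp add: scaleR_conv_of_real field_simps)
  qed
  ultimately show ?thesis by (simp add: bessel_I_norm_def sums_iff)
qed

section \<open>Admissible weights and expansions of the factors\<close>

lemma set_integrable_sin_powr_weight:
  assumes "Re \<mu> > -1" and [measurable]: "b \<in> borel_measurable borel"
    and bound: "\<And>\<theta>. \<bar>b \<theta>\<bar> \<le> B"
  shows "set_integrable lborel {0..pi} (\<lambda>\<theta>. b \<theta> * norm (complex_of_real (sin \<theta>) powr \<mu>))"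
  unfolding set_integrable_def
proof (rule Bochner_Integration.integrable_bound)
  have B: "B \<ge> 0" using bound[of 0] by linarith
  show "integrable lborel (\<lambda>\<theta>. B * norm (indicator {0..pi} \<theta> *\<^sub>R (complex_of_real (sin \<theta>) powr \<mu>)))"
    using sin_powr_set_integrable[OF assms(1)] unfolding set_integrable_def
    by (intro integrable_mult_right integrable_norm)
  show "AE \<theta> in lborel. norm (indicator {0..pi} \<theta> *\<^sub>R (b \<theta> * norm (complex_of_real (sin \<theta>) powr \<mu>))) \<le>
      norm (B * norm (indicator {0..pi} \<theta> *\<^sub>R (complex_of_real (sin \<theta>) powr \<mu>)))"
    using bound B by (intro AE_I2) (auto simp: indicator_def abs_mult intro!: mult_right_mono)
qed simp

lemma exp_mult_cos_le: "exp (a * cos \<theta>) \<le> exp \<bar>a :: real\<bar>"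
proof -
  have "a * cos \<theta> \<le> \<bar>a * cos \<theta>\<bar>" by simp
  also have "\<dots> \<le> \<bar>a\<bar>" by (simp add: abs_mult mult_left_le)
  finally show ?thesis by simp
qed

text \<open>The first weight serves the factor with argument tx/(1-t), the second the factor with
  argument x/(1-t), where exp(-x cos \<theta>) is split off.\<close>

lemma sin_weight_integrable:
  assumes "Re \<mu> > -1"
  shows "set_integrable lborel {0..pi} (\<lambda>\<theta>. exp (\<bar>x * cos \<theta>\<bar> / 2) * norm (complex_of_real (sin \<theta>) powr \<mu>))"
    and "set_integrable lborel {0..pi} (\<lambda>\<theta>. exp (\<bar>x * cos \<theta>\<bar> / 2) *
      norm (of_real (exp (- (x * cos \<theta>))) * complex_of_real (sin \<theta>) powr \<mu>))"
proof -
  have *: "exp (\<bar>x * cos \<theta>\<bar> / 2) \<le> exp \<bar>x\<bar>" for \<theta>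
    using mult_left_le[of "\<bar>cos \<theta>\<bar>" "\<bar>x\<bar>"] by (simp add: abs_mult)
  show "set_integrable lborel {0..pi} (\<lambda>\<theta>. exp (\<bar>x * cos \<theta>\<bar> / 2) * norm (complex_of_real (sin \<theta>) powr \<mu>))"
    by (rule set_integrable_sin_powr_weight[OF assms, where B = "exp \<bar>x\<bar>"]) (use * in auto)
  have "set_integrable lborel {0..pi} (\<lambda>\<theta>. exp (\<bar>x * cos \<theta>\<bar> / 2) * exp (- (x * cos \<theta>)) *
      norm (complex_of_real (sin \<theta>) powr \<mu>))"
  proof (rule set_integrable_sin_powr_weight[OF assms, where B = "exp \<bar>x\<bar> * exp \<bar>x\<bar>"])
    show "\<bar>exp (\<bar>x * cos \<theta>\<bar> / 2) * exp (- (x * cos \<theta>))\<bar> \<le> exp \<bar>x\<bar> * exp \<bar>x\<bar>" for \<theta>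
      using mult_mono[OF *[of \<theta>] exp_mult_cos_le[of "- x" \<theta>]] by (simp add: abs_mult)
  qed simp
  then show "set_integrable lborel {0..pi} (\<lambda>\<theta>. exp (\<bar>x * cos \<theta>\<bar> / 2) *
      norm (of_real (exp (- (x * cos \<theta>))) * complex_of_real (sin \<theta>) powr \<mu>))"
    by (simp add: norm_mult mult.assoc)
qed

lemma bessel_I_norm_left_expansion:
  assumes \<mu>: "Re \<mu> > -1"
  shows "(\<lambda>t. (1 - t) powr (- (\<mu> + 1) / 2) * bessel_I_norm (\<mu> / 2) (t * of_real x / (1 - t))) has_fps_expansion
    Abs_fps (\<lambda>i. 1 / (of_real (sqrt pi) * Gamma ((\<mu> + 1) / 2)) *
      integral {0..pi} (\<lambda>\<theta>. laguerre i ((\<mu> - 1) / 2) (x * cos \<theta>) * of_real (sin \<theta>) powr \<mu>))"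
proof -
  let ?c = "1 / (of_real (sqrt pi) * Gamma ((\<mu> + 1) / 2))"
  have "(\<lambda>t. (1 - t) powr (- ((\<mu> - 1) / 2) - 1) *
      (LINT \<theta>:{0..pi}|lborel. exp (- (t * of_real (x * cos \<theta>) / (1 - t))) * complex_of_real (sin \<theta>) powr \<mu>))
      has_fps_expansion Abs_fps (\<lambda>i. integral {0..pi} (\<lambda>\<theta>. laguerre i ((\<mu> - 1) / 2) (x * cos \<theta>) * of_real (sin \<theta>) powr \<mu>))"
    by (rule has_fps_expansion_laguerre_set_transform[OF _ _ _ sin_weight_integrable(1)[OF \<mu>]]) auto
  from has_fps_expansion_cmult_left[OF this, of ?c]
  have "(\<lambda>t. ?c * ((1 - t) powr (- ((\<mu> - 1) / 2) - 1) *
      (LINT \<theta>:{0..pi}|lborel. exp (- (t * of_real (x * cos \<theta>) / (1 - t))) * complex_of_real (sin \<theta>) powr \<mu>)))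
      has_fps_expansion Abs_fps (\<lambda>i. ?c * integral {0..pi} (\<lambda>\<theta>. laguerre i ((\<mu> - 1) / 2) (x * cos \<theta>) * of_real (sin \<theta>) powr \<mu>))"
    by (simp add: fps_eq_iff has_fps_expansion_schematicI)
  moreover have "?c * ((1 - t) powr (- ((\<mu> - 1) / 2) - 1) *
      (LINT \<theta>:{0..pi}|lborel. exp (- (t * of_real (x * cos \<theta>) / (1 - t))) * complex_of_real (sin \<theta>) powr \<mu>)) =
      (1 - t) powr (- (\<mu> + 1) / 2) * bessel_I_norm (\<mu> / 2) (t * of_real x / (1 - t))" for t
  proof -
    have "- ((\<mu> - 1) / 2) - 1 = - (\<mu> + 1) / 2" by (simp add: field_simps)
    moreover have "t * of_real (x * cos \<theta>) / (1 - t) = t * of_real x / (1 - t) * of_real (cos \<theta>)" for \<theta> by simp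
    ultimately show ?thesis unfolding bessel_I_norm_Poisson[OF \<mu>] by (simp only: mult_ac)
  qed
  ultimately show ?thesis by (simp only:)
qed

lemma bessel_I_norm_right_expansion:
  assumes \<nu>: "Re \<nu> > -1"
  shows "(\<lambda>t. (1 - t) powr (- (\<nu> + 1) / 2) * bessel_I_norm (\<nu> / 2) (of_real x / (1 - t))) has_fps_expansion
    Abs_fps (\<lambda>i. 1 / (of_real (sqrt pi) * Gamma ((\<nu> + 1) / 2)) *
      integral {0..pi} (\<lambda>\<phi>. laguerre i ((\<nu> - 1) / 2) (x * cos \<phi>) *
        (of_real (exp (- (x * cos \<phi>))) * of_real (sin \<phi>) powr \<nu>)))"
proof -
  let ?c = "1 / (of_real (sqrt pi) * Gamma ((\<nu> + 1) / 2))"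
  let ?w = "\<lambda>\<phi>. of_real (exp (- (x * cos \<phi>))) * complex_of_real (sin \<phi>) powr \<nu>"
  have "(\<lambda>t. (1 - t) powr (- ((\<nu> - 1) / 2) - 1) *
      (LINT \<phi>:{0..pi}|lborel. exp (- (t * of_real (x * cos \<phi>) / (1 - t))) * ?w \<phi>))
      has_fps_expansion Abs_fps (\<lambda>i. integral {0..pi} (\<lambda>\<phi>. laguerre i ((\<nu> - 1) / 2) (x * cos \<phi>) * ?w \<phi>))"
    by (rule has_fps_expansion_laguerre_set_transform[OF _ _ _ sin_weight_integrable(2)[OF \<nu>]]) auto
  from has_fps_expansion_cmult_left[OF this, of ?c]
  have exp: "(\<lambda>t. ?c * ((1 - t) powr (- ((\<nu> - 1) / 2) - 1) *
      (LINT \<phi>:{0..pi}|lborel. exp (- (t * of_real (x * cos \<phi>) / (1 - t))) * ?w \<phi>)))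
      has_fps_expansion Abs_fps (\<lambda>i. ?c * integral {0..pi} (\<lambda>\<phi>. laguerre i ((\<nu> - 1) / 2) (x * cos \<phi>) * ?w \<phi>))"
    by (simp add: fps_eq_iff has_fps_expansion_schematicI)
  have "?c * ((1 - t) powr (- ((\<nu> - 1) / 2) - 1) *
      (LINT \<phi>:{0..pi}|lborel. exp (- (t * of_real (x * cos \<phi>) / (1 - t))) * ?w \<phi>)) =
      (1 - t) powr (- (\<nu> + 1) / 2) * bessel_I_norm (\<nu> / 2) (of_real x / (1 - t))" if t: "t \<noteq> 1" for t
  proof -
    have "- ((\<nu> - 1) / 2) - 1 = - (\<nu> + 1) / 2" by (simp add: field_simps)
    moreover have "exp (- (t * of_real (x * cos \<phi>) / (1 - t))) * ?w \<phi> =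
        exp (- (of_real x / (1 - t) * of_real (cos \<phi>))) * complex_of_real (sin \<phi>) powr \<nu>" for \<phi>
      using exp_split_one_minus[OF t, of "of_real (x * cos \<phi>)"]
      by (simp add: mult.assoc[symmetric] exp_of_real[symmetric])
    ultimately show ?thesis unfolding bessel_I_norm_Poisson[OF \<nu>] by (simp only: mult_ac)
  qed
  with eventually_neq_1_nhds_0 have "eventually (\<lambda>t. ?c * ((1 - t) powr (- ((\<nu> - 1) / 2) - 1) *
      (LINT \<phi>:{0..pi}|lborel. exp (- (t * of_real (x * cos \<phi>) / (1 - t))) * ?w \<phi>)) =
      (1 - t) powr (- (\<nu> + 1) / 2) * bessel_I_norm (\<nu> / 2) (of_real x / (1 - t))) (nhds 0)"
    by (rule eventually_mono)
  with exp show ?thesis by (rule has_fps_expansion_transfer)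
qed

text \<open>The growth exp(x cosh \<phi> / 2) uses up half of the decay; what is left is the Poisson
  integrand at z = x/2, already known to be integrable.\<close>

lemma cosh_sinh_weight:
  assumes \<nu>: "Re \<nu> > -1" and x: "x > 0"
  shows "set_integrable lborel {0..} (\<lambda>\<phi>. exp (\<bar>x * cosh \<phi>\<bar> / 2) *
      norm (of_real (exp (- (x * cosh \<phi>))) * complex_of_real (sinh \<phi>) powr \<nu>))"
proof -
  have "integrable lborel (\<lambda>\<phi>. norm (indicator {0<..} \<phi> *\<^sub>R
      (of_real (exp (- (x / 2 * cosh \<phi>))) * complex_of_real (sinh \<phi>) powr \<nu>)))"
    using bessel_K_norm_Poisson_of_real[OF \<nu>, of "x / 2"] x by (intro integrable_norm) (auto simp: has_bochner_integral_iff)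
  also have "(\<lambda>\<phi>. norm (indicator {0<..} \<phi> *\<^sub>R
      (of_real (exp (- (x / 2 * cosh \<phi>))) * complex_of_real (sinh \<phi>) powr \<nu>))) =
      (\<lambda>\<phi>. indicator {0..} \<phi> *\<^sub>R (exp (\<bar>x * cosh \<phi>\<bar> / 2) *
      norm (of_real (exp (- (x * cosh \<phi>))) * complex_of_real (sinh \<phi>) powr \<nu>)))"
  proof
    fix \<phi> :: real
    have "exp (- (x / 2 * cosh \<phi>)) = exp (\<bar>x * cosh \<phi>\<bar> / 2) * exp (- (x * cosh \<phi>))"
      using x by (simp add: abs_mult field_simps flip: exp_add)
    then show "norm (indicator {0<..} \<phi> *\<^sub>R
        (of_real (exp (- (x / 2 * cosh \<phi>))) * complex_of_real (sinh \<phi>) powr \<nu>)) =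
        indicator {0..} \<phi> *\<^sub>R (exp (\<bar>x * cosh \<phi>\<bar> / 2) *
        norm (of_real (exp (- (x * cosh \<phi>))) * complex_of_real (sinh \<phi>) powr \<nu>))"
      \<comment> \<open>The half-lines differ only at 0, where both sides vanish because
        \<open>sinh 0 = 0\<close> and \<open>0 powr \<nu> = 0\<close>.\<close>
      by (cases "\<phi> = 0") (auto simp: indicator_def norm_mult)
  qed
  finally show ?thesis unfolding set_integrable_def .
qed

lemma bessel_K_norm_expansion:
  assumes \<nu>: "Re \<nu> > -1" and x: "x > 0"
  shows "(\<lambda>t. (1 - t) powr (- (\<nu> + 1) / 2) * bessel_K_norm (\<nu> / 2) (of_real x / (1 - t))) has_fps_expansion
    Abs_fps (\<lambda>i. of_real (sqrt pi) / Gamma ((\<nu> + 1) / 2) *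
      integral {0..} (\<lambda>\<phi>. laguerre i ((\<nu> - 1) / 2) (x * cosh \<phi>) *
        (of_real (exp (- (x * cosh \<phi>))) * of_real (sinh \<phi>) powr \<nu>)))"
proof -
  let ?c = "of_real (sqrt pi) / Gamma ((\<nu> + 1) / 2)"
  let ?w = "\<lambda>\<phi>. of_real (exp (- (x * cosh \<phi>))) * complex_of_real (sinh \<phi>) powr \<nu>"
  define T where "T = (\<lambda>t. LINT \<phi>:{0..}|lborel. exp (- (t * of_real (x * cosh \<phi>) / (1 - t))) * ?w \<phi>)"
  \<comment> \<open>\<open>T\<close> does not involve the order \<alpha>. Order -1 expands
    \<open>T\<close> alone, which the identity theorem needs for comparison with the Bessel
    function; order (\<nu> - 1)/2 then gives the coefficients with the right prefactor.\<close>
  have trans: "(\<lambda>t. (1 - t) powr (- \<alpha> - 1) * T t) has_fps_expansion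
      Abs_fps (\<lambda>i. integral {0..} (\<lambda>\<phi>. laguerre i \<alpha> (x * cosh \<phi>) * ?w \<phi>))" for \<alpha>
    unfolding T_def by (rule has_fps_expansion_laguerre_set_transform[OF _ _ _ cosh_sinh_weight[OF \<nu> x]]) auto
  have G: "Gamma ((\<nu> + 1) / 2) \<noteq> 0" using \<nu> by (intro Gamma_nonzero_Re_pos) simp
  obtain F where F: "(\<lambda>t. bessel_K_norm (\<nu> / 2) (of_real x / (1 - t))) has_fps_expansion F"
    using bessel_K_norm_has_fps_expansion[OF x] by blast
  have "eventually (\<lambda>t. bessel_K_norm (\<nu> / 2) (of_real x / (1 - t)) = ?c * ((1 - t) powr (- (- 1) - 1) * T t)) (nhds 0)"
  proof (rule has_fps_expansion_eventually_eq[OF F has_fps_expansion_cmult_left[OF trans]])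
    fix t :: real assume t: "0 < t" "t < 1"
    define z where "z = x / (1 - t)"
    have z: "z > 0" using t x by (simp add: z_def)
    have "T (of_real t) = (\<integral>\<phi>. indicator {0<..} \<phi> *\<^sub>R (of_real (exp (- (z * cosh \<phi>))) * complex_of_real (sinh \<phi>) powr \<nu>) \<partial>lborel)"
      unfolding T_def set_lebesgue_integral_def
    proof (intro Bochner_Integration.integral_cong refl)
      fix \<phi> :: real
      have "exp (- (of_real t * of_real (x * cosh \<phi>) / (1 - of_real t))) * complex_of_real (exp (- (x * cosh \<phi>))) =
          of_real (exp (- (z * cosh \<phi>)))"
        using exp_split_one_minus[of "of_real t" "of_real (x * cosh \<phi>)"] t
        by (simp add: z_def exp_of_real[symmetric])
      then have "exp (- (of_real t * of_real (x * cosh \<phi>) / (1 - of_real t))) * ?w \<phi> =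
          of_real (exp (- (z * cosh \<phi>))) * complex_of_real (sinh \<phi>) powr \<nu>"
        by (simp only: mult.assoc[symmetric])
      then show "indicator {0..} \<phi> *\<^sub>R (exp (- (of_real t * of_real (x * cosh \<phi>) / (1 - of_real t))) * ?w \<phi>) =
          indicator {0<..} \<phi> *\<^sub>R (of_real (exp (- (z * cosh \<phi>))) * complex_of_real (sinh \<phi>) powr \<nu>)"
        by (cases "\<phi> = 0") (simp_all add: indicator_def)
    qed
    also have "\<dots> = Gamma ((\<nu> + 1) / 2) / of_real (sqrt pi) * bessel_K_norm (\<nu> / 2) (of_real z)"
      by (rule has_bochner_integral_integral_eq[OF bessel_K_norm_Poisson_of_real[OF \<nu> z]])
    finally have "bessel_K_norm (\<nu> / 2) (of_real z) = ?c * T (of_real t)"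
      using G by (simp add: field_simps)
    moreover have "of_real x / (1 - complex_of_real t) = of_real z" by (simp add: z_def)
    moreover have "(1 - complex_of_real t) powr (- (- 1) - 1) = 1" using t by simp
    ultimately show "bessel_K_norm (\<nu> / 2) (of_real x / (1 - of_real t)) =
        ?c * ((1 - of_real t) powr (- (- 1) - 1) * T (of_real t))" by simp
  qed simp
  then have "eventually (\<lambda>t. ?c * ((1 - t) powr (- ((\<nu> - 1) / 2) - 1) * T t) =
      (1 - t) powr (- (\<nu> + 1) / 2) * bessel_K_norm (\<nu> / 2) (of_real x / (1 - t))) (nhds 0)"
    using eventually_neq_1_nhds_0
  proof eventually_elim
    case (elim t)
    have e: "- ((\<nu> - 1) / 2) - 1 = - (\<nu> + 1) / 2" by (simp add: field_simps)
    show ?case unfolding e using elim by simp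
  qed
  moreover have "(\<lambda>t. ?c * ((1 - t) powr (- ((\<nu> - 1) / 2) - 1) * T t)) has_fps_expansion
      Abs_fps (\<lambda>i. ?c * integral {0..} (\<lambda>\<phi>. laguerre i ((\<nu> - 1) / 2) (x * cosh \<phi>) * ?w \<phi>))"
    using has_fps_expansion_cmult_left[OF trans, of ?c] by (rule has_fps_expansion_schematicI) (simp add: fps_eq_iff)
  ultimately show ?thesis by (rule has_fps_expansion_transfer[rotated])
qed

lemma has_fps_expansion_exp_one_minus:
  "(\<lambda>t. exp (- (of_real y / (1 - t)))) has_fps_expansion
     Abs_fps (\<lambda>i. exp (- of_real y) * laguerre i (- 1) y)"
proof -
  have "(\<lambda>t. exp (- of_real y) * ((1 - t) powr (- (- 1) - 1) * exp (- (t * of_real y / (1 - t))))) has_fps_expansion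
     Abs_fps (\<lambda>i. exp (- of_real y) * laguerre i (- 1) y)"
    using has_fps_expansion_cmult_left[OF has_fps_expansion_laguerre_kernel]
    by (rule has_fps_expansion_schematicI) (simp add: fps_eq_iff)
  moreover have "eventually (\<lambda>t::complex. exp (- of_real y) * ((1 - t) powr (- (- 1) - 1) * exp (- (t * of_real y / (1 - t)))) =
      exp (- (of_real y / (1 - t)))) (nhds 0)"
    using eventually_neq_1_nhds_0
  proof eventually_elim
    case (elim t)
    then show ?case using exp_split_one_minus[of t "of_real y"] by (simp add: mult.commute)
  qed
  ultimately show ?thesis by (rule has_fps_expansion_transfer)
qed

text \<open>The hyperbolic cosine is half the sum of the exponentials at x and -x; these two terms
  become the sum over i in the formula for \<nu> = -1.\<close>

lemma bessel_I_norm_neg_half_expansion: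
  "(\<lambda>t. bessel_I_norm (- 1 / 2) (of_real x / (1 - t))) has_fps_expansion
     Abs_fps (\<lambda>i. 1 / (2 * of_real (sqrt pi)) *
       (exp (- of_real x) * laguerre i (- 1) x + exp (- of_real (- x)) * laguerre i (- 1) (- x)))"
proof -
  have "(\<lambda>t. 1 / (2 * of_real (sqrt pi)) * (exp (- (of_real x / (1 - t))) + exp (- (of_real (- x) / (1 - t)))))
      has_fps_expansion fps_const (1 / (2 * of_real (sqrt pi))) *
       (Abs_fps (\<lambda>i. exp (- of_real x) * laguerre i (- 1) x) + Abs_fps (\<lambda>i. exp (- of_real (- x)) * laguerre i (- 1) (- x)))"
    by (intro has_fps_expansion_cmult_left has_fps_expansion_add has_fps_expansion_exp_one_minus)
  moreover have "1 / (2 * of_real (sqrt pi)) * (exp (- (of_real x / (1 - t))) + exp (- (of_real (- x) / (1 - t)))) =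
      bessel_I_norm (- 1 / 2) (of_real x / (1 - t))" for t
    unfolding bessel_I_norm_neg_half by (simp add: cosh_field_def add.commute)
  moreover have "fps_const (1 / (2 * of_real (sqrt pi))) *
       (Abs_fps (\<lambda>i. exp (- of_real x) * laguerre i (- 1) x) + Abs_fps (\<lambda>i. exp (- of_real (- x)) * laguerre i (- 1) (- x))) =
       Abs_fps (\<lambda>i. 1 / (2 * of_real (sqrt pi)) *
       (exp (- of_real x) * laguerre i (- 1) x + exp (- of_real (- x)) * laguerre i (- 1) (- x)))"
    by (simp add: fps_eq_iff)
  ultimately show ?thesis by (simp only:)
qed

lemma bessel_K_norm_neg_half_expansion:
  assumes x: "x > 0"
  shows "(\<lambda>t. bessel_K_norm (- 1 / 2) (of_real x / (1 - t))) has_fps_expansion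
     Abs_fps (\<lambda>i. of_real (sqrt pi) / 2 * (exp (- of_real x) * laguerre i (- 1) x))"
proof -
  obtain F where F: "(\<lambda>t. bessel_K_norm (- 1 / 2) (of_real x / (1 - t))) has_fps_expansion F"
    using bessel_K_norm_has_fps_expansion[OF x] by blast
  have E: "(\<lambda>t. of_real (sqrt pi) / 2 * exp (- (of_real x / (1 - t)))) has_fps_expansion
      fps_const (of_real (sqrt pi) / 2) * Abs_fps (\<lambda>i. exp (- of_real x) * laguerre i (- 1) x)"
    by (intro has_fps_expansion_cmult_left has_fps_expansion_exp_one_minus)
  have "eventually (\<lambda>t. of_real (sqrt pi) / 2 * exp (- (of_real x / (1 - t))) =
      bessel_K_norm (- 1 / 2) (of_real x / (1 - t))) (nhds 0)"
  proof (rule has_fps_expansion_eventually_eq[OF E F zero_less_one])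
    fix t :: real assume t: "0 < t" "t < 1"
    define z where "z = x / (1 - t)"
    have z: "z > 0" using t x by (simp add: z_def)
    have eq: "of_real x / (1 - complex_of_real t) = of_real z" by (simp add: z_def)
    show "of_real (sqrt pi) / 2 * exp (- (of_real x / (1 - of_real t))) =
        bessel_K_norm (- 1 / 2) (of_real x / (1 - of_real t))"
      unfolding eq bessel_K_norm_neg_half_of_real[OF z] by (simp add: exp_of_real[symmetric])
  qed
  with E have "(\<lambda>t. bessel_K_norm (- 1 / 2) (of_real x / (1 - t))) has_fps_expansion
      fps_const (of_real (sqrt pi) / 2) * Abs_fps (\<lambda>i. exp (- of_real x) * laguerre i (- 1) x)"
    by (rule has_fps_expansion_transfer)
  then show ?thesis by (rule has_fps_expansion_schematicI) (simp add: fps_eq_iff)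
qed

section \<open>Assembly of the four integral formulas\<close>

theorem theorem5p1:
  fixes j :: nat and \<mu> \<nu> :: complex and x :: real
  assumes hx: "x > 0" and h\<mu>: "Re \<mu> > -1"
  shows "(Re \<nu> > -1 \<longrightarrow>
           Lambda1 \<mu> \<nu> j x =
             1 / (of_real pi * Gamma ((\<mu> + 1) / 2) * Gamma ((\<nu> + 1) / 2)) *
             integral {0..pi} (\<lambda>\<theta>. integral {0..pi} (\<lambda>\<phi>.
                exp (- of_real (x * cos \<phi>)) *
                laguerre j ((\<mu> + \<nu>) / 2) (x * (cos \<theta> + cos \<phi>)) *
                of_real (sin \<theta>) powr \<mu> * of_real (sin \<phi>) powr \<nu>))
         \<and> Lambda2 \<mu> \<nu> j x =
             1 / (Gamma ((\<mu> + 1) / 2) * Gamma ((\<nu> + 1) / 2)) *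
             integral {0..pi} (\<lambda>\<theta>. integral {0..} (\<lambda>\<phi>.
                exp (- of_real (x * cosh \<phi>)) *
                laguerre j ((\<mu> + \<nu>) / 2) (x * (cos \<theta> + cosh \<phi>)) *
                of_real (sin \<theta>) powr \<mu> * of_real (sinh \<phi>) powr \<nu>)))
       \<and> Lambda1 \<mu> (-1) j x =
           1 / (2 * of_real pi * Gamma ((\<mu> + 1) / 2)) *
           (\<Sum>i\<in>{0, 1::nat}. integral {0..pi} (\<lambda>\<theta>.
              exp (- of_real ((-1) ^ i * x)) *
              laguerre j ((\<mu> - 1) / 2) (x * (cos \<theta> + (-1) ^ i)) *
              of_real (sin \<theta>) powr \<mu>))
       \<and> Lambda2 \<mu> (-1) j x =
           1 / (2 * Gamma ((\<mu> + 1) / 2)) *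
           integral {0..pi} (\<lambda>\<theta>.
              exp (- of_real x) *
              laguerre j ((\<mu> - 1) / 2) (x * (cos \<theta> + 1)) *
              of_real (sin \<theta>) powr \<mu>)"
proof -
  define a where "a = 1 / (complex_of_real (sqrt pi) * Gamma ((\<mu> + 1) / 2))"
  define A where "A = (\<lambda>i. integral {0..pi} (\<lambda>\<theta>. laguerre i ((\<mu> - 1) / 2) (x * cos \<theta>) * complex_of_real (sin \<theta>) powr \<mu>))"
  have sqrt_pi: "complex_of_real (sqrt pi) * complex_of_real (sqrt pi) = of_real pi"
    by (simp flip: of_real_mult)
  have left: "(\<lambda>t. (1 - t) powr (- (\<mu> + 1) / 2) * bessel_I_norm (\<mu> / 2) (t * of_real x / (1 - t)))
      has_fps_expansion Abs_fps (\<lambda>i. a * A i)"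
    unfolding a_def A_def by (rule bessel_I_norm_left_expansion[OF h\<mu>])
  have left_int: "(\<lambda>\<theta>. laguerre i ((\<mu> - 1) / 2) (x * cos \<theta>) * complex_of_real (sin \<theta>) powr \<mu>) integrable_on {0..pi}" for i
    by (rule laguerre_integrable_on[OF _ _ _ sin_weight_integrable(1)[OF h\<mu>]]) auto
  have split: "(1 - t) powr (- (\<mu> + \<nu> + 2) / 2) = (1 - t) powr (- (\<mu> + 1) / 2) * (1 - t) powr (- (\<nu> + 1) / 2)" for t \<nu>
  proof -
    have "- (\<mu> + \<nu> + 2) / 2 = - (\<mu> + 1) / 2 + - (\<nu> + 1) / 2" by (simp add: field_simps)
    then show ?thesis by (simp only: powr_add)
  qed
  have order: "(\<mu> - 1) / 2 + (\<nu> - 1) / 2 + 1 = (\<mu> + \<nu>) / 2" for \<nu> by (simp add: field_simps)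
  have part1: "Lambda1 \<mu> \<nu> j x =
      1 / (of_real pi * Gamma ((\<mu> + 1) / 2) * Gamma ((\<nu> + 1) / 2)) *
      integral {0..pi} (\<lambda>\<theta>. integral {0..pi} (\<lambda>\<phi>.
        exp (- of_real (x * cos \<phi>)) * laguerre j ((\<mu> + \<nu>) / 2) (x * (cos \<theta> + cos \<phi>)) *
        of_real (sin \<theta>) powr \<mu> * of_real (sin \<phi>) powr \<nu>))" if h\<nu>: "Re \<nu> > -1"
  proof -
    let ?w = "\<lambda>\<phi>. of_real (exp (- (x * cos \<phi>))) * complex_of_real (sin \<phi>) powr \<nu>"
    define b where "b = 1 / (complex_of_real (sqrt pi) * Gamma ((\<nu> + 1) / 2))"
    define B where "B = (\<lambda>i. integral {0..pi} (\<lambda>\<phi>. laguerre i ((\<nu> - 1) / 2) (x * cos \<phi>) * ?w \<phi>))"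
    have right_int: "(\<lambda>\<phi>. laguerre i ((\<nu> - 1) / 2) (x * cos \<phi>) * ?w \<phi>) integrable_on {0..pi}" for i
      by (rule laguerre_integrable_on[OF _ _ _ sin_weight_integrable(2)[OF h\<nu>]]) auto
    have "Lambda1 \<mu> \<nu> j x = (\<Sum>i=0..j. (a * A i) * (b * B (j - i)))"
      unfolding Lambda1_def
    proof (rule taylor_coeff_product[OF left])
      show "(\<lambda>t. (1 - t) powr (- (\<nu> + 1) / 2) * bessel_I_norm (\<nu> / 2) (of_real x / (1 - t)))
          has_fps_expansion Abs_fps (\<lambda>i. b * B i)"
        unfolding b_def B_def by (rule bessel_I_norm_right_expansion[OF h\<nu>])
    qed (simp only: G1_def split mult_ac)
    also have "\<dots> = (a * b) * (\<Sum>i=0..j. A i * B (j - i))"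
      by (simp add: sum_distrib_left mult_ac)
    also have "(\<Sum>i=0..j. A i * B (j - i)) = integral {0..pi} (\<lambda>\<theta>. integral {0..pi} (\<lambda>\<phi>.
        laguerre j ((\<mu> - 1) / 2 + (\<nu> - 1) / 2 + 1) (x * cos \<theta> + x * cos \<phi>) * of_real (sin \<theta>) powr \<mu> * ?w \<phi>))"
      unfolding A_def B_def by (rule integral_laguerre_product[OF left_int right_int, symmetric])
    also have "\<dots> = integral {0..pi} (\<lambda>\<theta>. integral {0..pi} (\<lambda>\<phi>.
        exp (- of_real (x * cos \<phi>)) * laguerre j ((\<mu> + \<nu>) / 2) (x * (cos \<theta> + cos \<phi>)) *
        of_real (sin \<theta>) powr \<mu> * of_real (sin \<phi>) powr \<nu>))"
      unfolding order by (simp only: exp_of_real[symmetric] of_real_minus distrib_left mult_ac)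
    \<comment> \<open>Both Poisson constants carry 1/sqrt(pi), whence the pi. For the Macdonald
      function the second constant has sqrt(pi) in the numerator and it cancels.\<close>
    also have "a * b = 1 / (of_real pi * Gamma ((\<mu> + 1) / 2) * Gamma ((\<nu> + 1) / 2))"
      by (simp add: a_def b_def mult_ac flip: sqrt_pi)
    finally show ?thesis .
  qed
  have part2: "Lambda2 \<mu> \<nu> j x =
      1 / (Gamma ((\<mu> + 1) / 2) * Gamma ((\<nu> + 1) / 2)) *
      integral {0..pi} (\<lambda>\<theta>. integral {0..} (\<lambda>\<phi>.
        exp (- of_real (x * cosh \<phi>)) * laguerre j ((\<mu> + \<nu>) / 2) (x * (cos \<theta> + cosh \<phi>)) *
        of_real (sin \<theta>) powr \<mu> * of_real (sinh \<phi>) powr \<nu>))" if h\<nu>: "Re \<nu> > -1"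
  proof -
    let ?w = "\<lambda>\<phi>. of_real (exp (- (x * cosh \<phi>))) * complex_of_real (sinh \<phi>) powr \<nu>"
    define b where "b = complex_of_real (sqrt pi) / Gamma ((\<nu> + 1) / 2)"
    define B where "B = (\<lambda>i. integral {0..} (\<lambda>\<phi>. laguerre i ((\<nu> - 1) / 2) (x * cosh \<phi>) * ?w \<phi>))"
    have right_int: "(\<lambda>\<phi>. laguerre i ((\<nu> - 1) / 2) (x * cosh \<phi>) * ?w \<phi>) integrable_on {0..}" for i
      by (rule laguerre_integrable_on[OF _ _ _ cosh_sinh_weight[OF h\<nu> hx]]) auto
    have "Lambda2 \<mu> \<nu> j x = (\<Sum>i=0..j. (a * A i) * (b * B (j - i)))"
      unfolding Lambda2_def
    proof (rule taylor_coeff_product[OF left])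
      show "(\<lambda>t. (1 - t) powr (- (\<nu> + 1) / 2) * bessel_K_norm (\<nu> / 2) (of_real x / (1 - t)))
          has_fps_expansion Abs_fps (\<lambda>i. b * B i)"
        unfolding b_def B_def by (rule bessel_K_norm_expansion[OF h\<nu> hx])
    qed (simp only: G2_def split mult_ac)
    also have "\<dots> = (a * b) * (\<Sum>i=0..j. A i * B (j - i))"
      by (simp add: sum_distrib_left mult_ac)
    also have "(\<Sum>i=0..j. A i * B (j - i)) = integral {0..pi} (\<lambda>\<theta>. integral {0..} (\<lambda>\<phi>.
        laguerre j ((\<mu> - 1) / 2 + (\<nu> - 1) / 2 + 1) (x * cos \<theta> + x * cosh \<phi>) * of_real (sin \<theta>) powr \<mu> * ?w \<phi>))"
      unfolding A_def B_def by (rule integral_laguerre_product[OF left_int right_int, symmetric])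
    also have "\<dots> = integral {0..pi} (\<lambda>\<theta>. integral {0..} (\<lambda>\<phi>.
        exp (- of_real (x * cosh \<phi>)) * laguerre j ((\<mu> + \<nu>) / 2) (x * (cos \<theta> + cosh \<phi>)) *
        of_real (sin \<theta>) powr \<mu> * of_real (sinh \<phi>) powr \<nu>))"
      unfolding order by (simp only: exp_of_real[symmetric] of_real_minus distrib_left mult_ac)
    also have "a * b = 1 / (Gamma ((\<mu> + 1) / 2) * Gamma ((\<nu> + 1) / 2))"
      by (simp add: a_def b_def)
    finally show ?thesis .
  qed
  \<comment> \<open>The point c = 1 or -1 takes the place of cos \<phi> or cosh \<phi>, with second
    Laguerre order -1, so the total order is (\<mu> - 1)/2.\<close>
  have shift: "(\<Sum>i=0..j. A i * (exp (- of_real (c * x)) * laguerre (j - i) (- 1) (c * x))) =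
      integral {0..pi} (\<lambda>\<theta>. exp (- of_real (c * x)) * laguerre j ((\<mu> - 1) / 2) (x * (cos \<theta> + c)) *
        of_real (sin \<theta>) powr \<mu>)" for c :: real
  proof -
    have "(\<Sum>i=0..j. A i * (exp (- of_real (c * x)) * laguerre (j - i) (- 1) (c * x))) =
        exp (- of_real (c * x)) * (\<Sum>i=0..j. A i * laguerre (j - i) (- 1) (c * x))"
      by (simp add: sum_distrib_left mult_ac)
    also have "(\<Sum>i=0..j. A i * laguerre (j - i) (- 1) (c * x)) =
        integral {0..pi} (\<lambda>\<theta>. laguerre j ((\<mu> - 1) / 2 + - 1 + 1) (x * cos \<theta> + c * x) * of_real (sin \<theta>) powr \<mu>)"
      unfolding A_def by (rule integral_laguerre_shift[OF left_int, symmetric])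
    also have "exp (- of_real (c * x)) * \<dots> = integral {0..pi} (\<lambda>\<theta>. exp (- of_real (c * x)) *
        (laguerre j ((\<mu> - 1) / 2 + - 1 + 1) (x * cos \<theta> + c * x) * of_real (sin \<theta>) powr \<mu>))"
      by (rule integral_mult_right[symmetric])
    also have "\<dots> = integral {0..pi} (\<lambda>\<theta>. exp (- of_real (c * x)) * laguerre j ((\<mu> - 1) / 2) (x * (cos \<theta> + c)) *
        of_real (sin \<theta>) powr \<mu>)"
      by (simp only: distrib_left mult.commute[of c x] mult.assoc) simp
    finally show ?thesis .
  qed
  \<comment> \<open>At \<nu> = -1 the first factor takes the whole power of 1 - t.\<close>
  have split': "(1 - t) powr (- (\<mu> + - 1 + 2) / 2) = (1 - t) powr (- (\<mu> + 1) / 2)" for t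
  proof -
    have "- (\<mu> + - 1 + 2) / 2 = - (\<mu> + 1) / 2" by (simp add: field_simps)
    then show ?thesis by (simp only:)
  qed
  have part3: "Lambda1 \<mu> (-1) j x = 1 / (2 * of_real pi * Gamma ((\<mu> + 1) / 2)) *
      (\<Sum>i\<in>{0, 1::nat}. integral {0..pi} (\<lambda>\<theta>. exp (- of_real ((-1) ^ i * x)) *
        laguerre j ((\<mu> - 1) / 2) (x * (cos \<theta> + (-1) ^ i)) * of_real (sin \<theta>) powr \<mu>))"
  proof -
    define b where "b = 1 / (2 * complex_of_real (sqrt pi))"
    let ?B = "\<lambda>c i. exp (- of_real (c * x)) * laguerre i (- 1) (c * x)"
    have "Lambda1 \<mu> (-1) j x = (\<Sum>i=0..j. (a * A i) * (b * (?B 1 (j - i) + ?B (- 1) (j - i))))"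
      unfolding Lambda1_def
    proof (rule taylor_coeff_product[OF left])
      show "(\<lambda>t. bessel_I_norm (- 1 / 2) (of_real x / (1 - t))) has_fps_expansion
          Abs_fps (\<lambda>i. b * (?B 1 i + ?B (- 1) i))"
        using bessel_I_norm_neg_half_expansion[of x] by (simp add: b_def)
    qed (simp only: G1_def split')
    also have "\<dots> = (a * b) * ((\<Sum>i=0..j. A i * ?B 1 (j - i)) + (\<Sum>i=0..j. A i * ?B (- 1) (j - i)))"
      by (simp only: sum.distrib[symmetric] sum_distrib_left distrib_left mult_ac)
    also have "a * b = 1 / (2 * of_real pi * Gamma ((\<mu> + 1) / 2))"
      by (simp add: a_def b_def mult_ac flip: sqrt_pi)
    finally show ?thesis unfolding shift by simp
  qed
  have part4: "Lambda2 \<mu> (-1) j x = 1 / (2 * Gamma ((\<mu> + 1) / 2)) *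
      integral {0..pi} (\<lambda>\<theta>. exp (- of_real x) * laguerre j ((\<mu> - 1) / 2) (x * (cos \<theta> + 1)) * of_real (sin \<theta>) powr \<mu>)"
  proof -
    define b where "b = complex_of_real (sqrt pi) / 2"
    \<comment> \<open>The redundant factor 1 lets \<open>shift\<close> apply syntactically with c =
      1.\<close>
    let ?B = "\<lambda>i. exp (- of_real (1 * x)) * laguerre i (- 1) (1 * x)"
    have "Lambda2 \<mu> (-1) j x = (\<Sum>i=0..j. (a * A i) * (b * ?B (j - i)))"
      unfolding Lambda2_def
    proof (rule taylor_coeff_product[OF left])
      show "(\<lambda>t. bessel_K_norm (- 1 / 2) (of_real x / (1 - t))) has_fps_expansion Abs_fps (\<lambda>i. b * ?B i)"
        using bessel_K_norm_neg_half_expansion[OF hx] by (simp add: b_def)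
    qed (simp only: G2_def split')
    also have "\<dots> = (a * b) * (\<Sum>i=0..j. A i * ?B (j - i))"
      by (simp only: sum_distrib_left mult_ac)
    also have "a * b = 1 / (2 * Gamma ((\<mu> + 1) / 2))"
      by (simp add: a_def b_def)
    finally show ?thesis unfolding shift by simp
  qed
  show ?thesis using part1 part2 part3 part4 by blast
qed

end
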